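(* Suppose that $q\alpha=a^2bcds$ and $\max\{|a|,|b|,|c|,|d|,|s|\}<1$. Then $$\int_{0}^{\pi}\frac{h(\cos 2\theta;1)}{h(\cos\theta;a,b,c,d,s)}\;{}_3\phi_2\left({{ae^{i\theta},\,ae^{-i\theta},\,\alpha uv/q}\atop{\alpha u,\ \alpha v}};q,bcds\right)d\theta$$ $$=\frac{2\pi\,(abcd,abcs,abds,acds;q)_\infty}{(q,ab,ac,ad,as,bc,bd,bs,cd,cs,ds,q\alpha;q)_\infty}\sum_{n=0}^\infty\frac{(1-\alpha q^{2n})(\alpha,q/u,q/v,ab,ac,ad,as;q)_n}{(1-\alpha)(q,\alpha u,\alpha v,abcd,abcs,abds,acds;q)_n}\left(-\frac{\alpha^2uv}{a^2}\right)^n q^{n(n-1)/2}.$$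
   Context: Here $q$ is a nonzero complex number with $|q|<1$, and $\alpha,a,b,c,d,s,u,v$ are complex parameters such that no zero factors occur in denominators. Notation: $(x;q)_0=1$, $(x;q)_n=\prod_{k=0}^{n-1}(1-xq^k)$ for $n=1,2,\dots$ or $n=\infty$, and $(x_1,\dots,x_r;q)_n=(x_1;q)_n\cdots(x_r;q)_n$. The basic hypergeometric series is $${}_3\phi_2\left({{a_1,a_2,a_3}\atop{b_1,b_2}};q,z\right)=\sum_{n=0}^\infty\frac{(a_1,a_2,a_3;q)_n}{(q,b_1,b_2;q)_n}z^n.$$ For $x=\cos\theta$, $h(x;a)=(ae^{i\theta},ae^{-i\theta};q)_\infty=\prod_{k=0}^\infty(1-2q^kax+q^{2k}a^2)$ and $h(x;a_1,\dots,a_m)=h(x;a_1)\cdots h(x;a_m)$. In particular $h(\cos 2\theta;1)=(e^{2i\theta},e^{-2i\theta};q)_\infty$. *)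

theory Defs
  imports "HOL-Analysis.Analysis"
begin

text \<open>
  The base \<open>q\<close> is always the first argument. The multi-parameter symbols
  $(x_1,\dots,x_r;q)_n$, $(x_1,\dots,x_r;q)_\infty$ and $h(x;a_1,\dots,a_m)$
  take the list of their parameters.
\<close>

definition qpoch :: "complex \<Rightarrow> complex \<Rightarrow> nat \<Rightarrow> complex" where
  "qpoch q x n = (\<Prod>k<n. 1 - x * q ^ k)"

definition qpoch_inf :: "complex \<Rightarrow> complex \<Rightarrow> complex" where
  "qpoch_inf q x = (\<Prod>k. 1 - x * q ^ k)"

definition qpochs :: "complex \<Rightarrow> complex list \<Rightarrow> nat \<Rightarrow> complex" where
  "qpochs q xs n = (\<Prod>x\<leftarrow>xs. qpoch q x n)"

definition qpochs_inf :: "complex \<Rightarrow> complex list \<Rightarrow> complex" where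
  "qpochs_inf q xs = (\<Prod>x\<leftarrow>xs. qpoch_inf q x)"

definition phi32 ::
  "complex \<Rightarrow> complex \<Rightarrow> complex \<Rightarrow> complex \<Rightarrow> complex \<Rightarrow> complex \<Rightarrow> complex \<Rightarrow> complex" where
  "phi32 q a1 a2 a3 b1 b2 z =
     (\<Sum>n. qpochs q [a1, a2, a3] n / qpochs q [q, b1, b2] n * z ^ n)"

text \<open>
  The product form of \<open>h(x;a)\<close> makes it a function of the real variable \<open>x\<close>;
  lemma \<open>h_cos\<close> below gives the form $(ae^{i\theta},ae^{-i\theta};q)_\infty$
  at $x=\cos\theta$.
\<close>

definition h :: "complex \<Rightarrow> real \<Rightarrow> complex \<Rightarrow> complex" where
  "h q x a = (\<Prod>k. 1 - 2 * q ^ k * a * of_real x + q ^ (2 * k) * a\<^sup>2)"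

definition hs :: "complex \<Rightarrow> real \<Rightarrow> complex list \<Rightarrow> complex" where
  "hs q x as = (\<Prod>a\<leftarrow>as. h q x a)"

lemma convergent_prod_qpoch_inf:
  fixes q x :: complex
  assumes "cmod q < 1"
  shows "convergent_prod (\<lambda>k. 1 - x * q ^ k)"
proof -
  have "summable (\<lambda>k. cmod (x * q ^ k))"
    using assms by (simp add: norm_mult norm_power summable_mult summable_geometric)
  then have "abs_convergent_prod (\<lambda>k. 1 - x * q ^ k)"
    by (simp add: abs_convergent_prod_conv_summable)
  then show ?thesis
    by (rule abs_convergent_prod_imp_convergent_prod)
qed

lemma h_cos:
  assumes "cmod q < 1"
  shows "h q (cos \<theta>) a =
    qpochs_inf q [a * exp (\<i> * of_real \<theta>), a * exp (- (\<i> * of_real \<theta>))]"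
proof -
  let ?e = "exp (\<i> * complex_of_real \<theta>)" and ?f = "exp (- (\<i> * complex_of_real \<theta>))"
  have ef: "?e * ?f = 1"
    by (simp flip: exp_add)
  have c: "2 * complex_of_real (cos \<theta>) = ?e + ?f"
    by (simp add: cos_of_real [symmetric] cos_exp_eq)
  have *: "(1 - a * ?e * q ^ k) * (1 - a * ?f * q ^ k)
      = 1 - 2 * q ^ k * a * of_real (cos \<theta>) + q ^ (2 * k) * a\<^sup>2" for k
  proof -
    have "(1 - a * ?e * q ^ k) * (1 - a * ?f * q ^ k)
      = 1 - q ^ k * a * (?e + ?f) + (q ^ k)\<^sup>2 * a\<^sup>2 * (?e * ?f)"
      by (simp only: algebra_simps power2_eq_square mult_1_left mult_1_right)
    then show ?thesis
      by (simp only: ef c [symmetric]) (simp add: algebra_simps flip: power_mult)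
  qed
  have "qpochs_inf q [a * ?e, a * ?f]
      = (\<Prod>k. (1 - a * ?e * q ^ k) * (1 - a * ?f * q ^ k))"
    unfolding qpochs_inf_def qpoch_inf_def
    using prodinf_mult [OF convergent_prod_qpoch_inf convergent_prod_qpoch_inf, OF assms assms]
    by simp
  then show ?thesis
    by (simp only: * h_def)
qed

end

theory Submission
  imports Defs "HOL-Complex_Analysis.Complex_Analysis"
begin

text \<open>
Write $w(\theta)=h(\cos 2\theta;1)$ and
$$I(a,b,c,d,s)=\int_0^\pi\frac{w(\theta)}{h(\cos\theta;a,b,c,d,s)}\,d\theta .$$
Since $(ae^{i\theta},ae^{-i\theta};q)_k/h(\cos\theta;a)=1/h(\cos\theta;aq^k)$, integrating the
${}_3\phi_2$ term by term turns the left-hand side into a sum over $k$ of multiples of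
$I(aq^k,b,c,d,s)$. The integral $I$ is itself a very-well-poised series
(\<open>askey_integral_eq_wp_series\<close>), summed over $n$. In the resulting double series, collect the terms
with $N=n+k$: the sum over $k$ is a balanced terminating ${}_3\phi_2$, and the
$q$-Pfaff--Saalschuetz formula (\<open>q_saalschuetz\<close>) evaluates it to the factor containing
$(q/u,q/v;q)_N$ of the right-hand side.

The evaluation of $I$ rests on one idea. The recurrence
$h(x;b)=(1-2bx+b^2)\,h(x;bq)$ implies the contiguous relation
$$(c-b)(1-bc)\,I(b,c)=c\,I(bq,c)-b\,I(b,cq)$$
for any two of the parameters, and a solution of this relation that is holomorphic in $b$ and
vanishes at $b=0$ vanishes identically (\<open>contiguous_unique\<close>). So a conjectured value of an integral
is correct if it is holomorphic, satisfies the same relation and is correct when one parameter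
is 0. In this way
one climbs from one parameter to four, which gives the Askey--Wilson integral, and from four to
five, where the relation for the series holds term by term after a summation by parts
(\<open>wp_series_contiguous\<close>).

The relation knows nothing about the weight, which enters at the bottom of the ladder. With one
parameter the integral does not depend on $a$: the difference of its values at $a$ and $aq$ is a
contour integral that vanishes by symmetry on the circle through $\sqrt q$
(\<open>theta_integral_0\<close>). The remaining constant $\int_0^\pi w$ follows from the Askey--Wilson integral
at $q,-q,\sqrt q,-\sqrt q$, where the integrand reduces to $2-2\cos 2\theta$.
\<close>

section \<open>The infinite product $(x;q)_\infty$\<close>

locale nome =
  fixes q :: complex
  assumes q_nonzero: "q \<noteq> 0" and q_norm: "cmod q < 1"
begin

abbreviation Q :: "complex \<Rightarrow> complex" where
  "Q \<equiv> qpoch_inf q"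

lemma norm_q_power_le_1: "cmod (q ^ n) \<le> 1"
  using q_norm by (simp add: norm_power power_le_one)

lemma norm_mult_q_power_le: "cmod (x * q ^ n) \<le> cmod x"
  using norm_q_power_le_1[of n] by (simp add: norm_mult mult_left_le)

lemma norm_mult_q_le: "cmod (x * q) \<le> cmod x"
  using norm_mult_q_power_le[of x 1] by simp

lemma norm_mult_less_1: "cmod x < 1 \<Longrightarrow> cmod y < 1 \<Longrightarrow> cmod (x * y) < 1"
  unfolding norm_mult by (metis mult_left_le norm_ge_zero less_imp_le le_less_trans)

lemma qpoch_LIMSEQ: "(\<lambda>n. qpoch q x n) \<longlonglongrightarrow> Q x"
  using convergent_prod_LIMSEQ[OF convergent_prod_qpoch_inf[OF q_norm, of x]]
  unfolding qpoch_def qpoch_inf_def LIMSEQ_lessThan_iff_atMost .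

lemma Q_split: "Q x = qpoch q x n * Q (x * q ^ n)"
proof -
  have "(\<Prod>k<n + m. 1 - x * q ^ k) = (\<Prod>k<n. 1 - x * q ^ k) * (\<Prod>k<m. 1 - x * q ^ (n + k))" for m
    by (induction m) (simp_all add: mult.assoc)
  then have "qpoch q x (n + m) = qpoch q x n * qpoch q (x * q ^ n) m" for m
    by (simp add: qpoch_def power_add mult.assoc)
  moreover have "(\<lambda>m. qpoch q x (n + m)) \<longlonglongrightarrow> Q x"
    using LIMSEQ_ignore_initial_segment[OF qpoch_LIMSEQ[of x], of n] by (simp add: add.commute)
  ultimately have "(\<lambda>m. qpoch q x n * qpoch q (x * q ^ n) m) \<longlonglongrightarrow> Q x"
    by simp
  moreover have "(\<lambda>m. qpoch q x n * qpoch q (x * q ^ n) m) \<longlonglongrightarrow> qpoch q x n * Q (x * q ^ n)"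
    by (intro tendsto_intros qpoch_LIMSEQ)
  ultimately show ?thesis
    by (rule LIMSEQ_unique)
qed

lemma Q_shift: "Q x = (1 - x) * Q (x * q)"
  using Q_split[of x 1] by (simp add: qpoch_def)

lemma Q_0 [simp]: "Q 0 = 1"
  by (simp add: qpoch_inf_def)

lemma Q_nonzero_iff: "Q x \<noteq> 0 \<longleftrightarrow> (\<forall>k. x * q ^ k \<noteq> 1)"
proof
  assume "Q x \<noteq> 0"
  show "\<forall>k. x * q ^ k \<noteq> 1"
  proof (rule allI, rule notI)
    fix k assume "x * q ^ k = 1"
    then have "qpoch q x (Suc k) = 0"
      by (simp add: qpoch_def)
    then show False
      using \<open>Q x \<noteq> 0\<close> Q_split[of x "Suc k"] by simp
  qed
next
  assume "\<forall>k. x * q ^ k \<noteq> 1"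
  then show "Q x \<noteq> 0"
    unfolding qpoch_inf_def
    by (intro prodinf_nonzero convergent_prod_qpoch_inf[OF q_norm]) auto
qed

lemma Q_nonzero: "cmod x < 1 \<Longrightarrow> Q x \<noteq> 0"
  using norm_mult_q_power_le[of x] unfolding Q_nonzero_iff
  by (metis leD norm_one)

lemma one_minus_nonzero: "cmod x < 1 \<Longrightarrow> 1 - x \<noteq> 0"
  by auto

lemma Q_holomorphic_UNIV: "Q holomorphic_on UNIV"
proof (rule holomorphic_uniform_sequence[OF open_UNIV])
  show "(\<lambda>x. qpoch q x n) holomorphic_on UNIV" for n
    unfolding qpoch_def by (intro holomorphic_intros)
  fix z :: complex
  let ?A = "cball z 1"
  have bound: "cmod x \<le> cmod z + 1" if "x \<in> ?A" for x
    using that norm_triangle_ineq2[of x z] by (simp add: dist_norm norm_minus_commute)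
  have "uniformly_convergent_on ?A (\<lambda>N x. \<Sum>n<N. norm ((1 - x * q ^ n) - 1))"
  proof (rule Weierstrass_m_test')
    show "norm (norm ((1 - x * q ^ n) - 1)) \<le> (cmod z + 1) * cmod q ^ n" if "x \<in> ?A" for n x
      using bound[OF that] by (simp add: norm_mult norm_power mult_right_mono)
    show "summable (\<lambda>n. (cmod z + 1) * cmod q ^ n)"
      using q_norm by (intro summable_mult summable_geometric) simp
  qed
  then have "uniformly_convergent_on ?A (\<lambda>N x. \<Prod>n<N. 1 - x * q ^ n)"
    by (intro uniformly_convergent_on_prod') (auto intro!: continuous_intros)
  then obtain l where l: "uniform_limit ?A (\<lambda>N x. qpoch q x N) l sequentially"
    unfolding uniformly_convergent_on_def qpoch_def by blast
  have "l x = Q x" if "x \<in> ?A" for x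
    using tendsto_uniform_limitI[OF l that] qpoch_LIMSEQ[of x] by (rule LIMSEQ_unique)
  then have "uniform_limit ?A (\<lambda>N x. qpoch q x N) Q sequentially"
    using l by (subst (asm) uniform_limit_cong'[of _ _ _ _ Q]) auto
  then show "\<exists>d>0. cball z d \<subseteq> UNIV \<and> uniform_limit (cball z d) (\<lambda>N x. qpoch q x N) Q sequentially"
    by (intro exI[of _ 1]) simp
qed

lemma Q_holomorphic [holomorphic_intros]:
  "f holomorphic_on A \<Longrightarrow> (\<lambda>x. Q (f x)) holomorphic_on A"
  using holomorphic_on_compose_gen[OF _ Q_holomorphic_UNIV, of f A] by (simp add: o_def)

lemma Q_continuous [continuous_intros]:
  "continuous_on A f \<Longrightarrow> continuous_on A (\<lambda>x. Q (f x))"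
  using continuous_on_compose2[OF holomorphic_on_imp_continuous_on[OF Q_holomorphic_UNIV], of A f]
  by simp

lemma deriv_Q_continuous [continuous_intros]:
  "continuous_on A f \<Longrightarrow> continuous_on A (\<lambda>x. deriv Q (f x))"
  using continuous_on_compose2[OF holomorphic_on_imp_continuous_on
      [OF holomorphic_deriv[OF Q_holomorphic_UNIV open_UNIV]], of A f]
  by simp

lemma Q_has_field_derivative: "(Q has_field_derivative deriv Q x) (at x)"
  using Q_holomorphic_UNIV by (intro holomorphic_derivI[of _ UNIV]) auto

lemma Q_bounded: "\<exists>M>0. \<forall>x. cmod x \<le> r \<longrightarrow> cmod (Q x) \<le> M"
proof -
  have "compact (Q ` cball 0 r)"
    by (intro compact_continuous_image Q_continuous continuous_intros compact_cball)
  then obtain M where "M > 0" "\<forall>y \<in> Q ` cball 0 r. cmod y \<le> M"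
    using compact_imp_bounded bounded_pos by metis
  then show ?thesis
    by (intro exI[of _ M]) auto
qed

lemma inverse_Q_bounded:
  assumes "r < 1"
  shows "\<exists>M>0. \<forall>x. cmod x \<le> r \<longrightarrow> cmod (inverse (Q x)) \<le> M"
proof -
  have "compact ((\<lambda>x. inverse (Q x)) ` cball 0 r)"
    using assms Q_nonzero
    by (intro compact_continuous_image continuous_intros compact_cball) auto
  then obtain M where "M > 0" "\<forall>y \<in> (\<lambda>x. inverse (Q x)) ` cball 0 r. cmod y \<le> M"
    using compact_imp_bounded bounded_pos by metis
  then show ?thesis
    by (intro exI[of _ M]) auto
qed

lemma qpoch_bounded: "\<exists>M>0. \<forall>n. cmod (qpoch q x n) \<le> M"
  using convergent_imp_Bseq[OF convergentI[OF qpoch_LIMSEQ[of x]]] by (auto simp: Bseq_def)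

lemma inverse_qpoch_bounded:
  assumes "Q x \<noteq> 0"
  shows "\<exists>M>0. \<forall>n. cmod (inverse (qpoch q x n)) \<le> M"
  using convergent_imp_Bseq[OF convergentI[OF tendsto_inverse[OF qpoch_LIMSEQ[of x] assms]]]
  by (auto simp: Bseq_def)

lemma qpoch_nonzero: "cmod x < 1 \<Longrightarrow> qpoch q x n \<noteq> 0"
  using Q_split[of x n] Q_nonzero[of x] by auto

lemma qpoch_Suc: "qpoch q x (Suc n) = qpoch q x n * (1 - x * q ^ n)"
  by (simp add: qpoch_def)

lemma qpoch_0 [simp]: "qpoch q x 0 = 1"
  by (simp add: qpoch_def)

section \<open>The integrals and their contiguous relation\<close>

text \<open>
At an angle $\theta$ the function $h(\cos\theta;a)$ is a product of two values of
$(\cdot;q)_\infty$ on a circle. This form, rather than the product over quadratic factors, is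
holomorphic in \<open>a\<close> at sight.
\<close>

definition H :: "complex \<Rightarrow> real \<Rightarrow> complex" where
  "H a \<theta> = Q (a * cis \<theta>) * Q (a * cis (- \<theta>))"

definition w :: "real \<Rightarrow> complex" where
  "w \<theta> = H 1 (2 * \<theta>)"

definition askey_integral ::
  "complex \<Rightarrow> complex \<Rightarrow> complex \<Rightarrow> complex \<Rightarrow> complex \<Rightarrow> complex" where
  "askey_integral a b c d s =
     integral {0..pi} (\<lambda>\<theta>. w \<theta> / (H a \<theta> * H b \<theta> * H c \<theta> * H d \<theta> * H s \<theta>))"

lemma h_eq_H: "h q (cos \<theta>) a = H a \<theta>"
  by (simp add: h_cos[OF q_norm] H_def qpochs_inf_def cis_conv_exp)

lemma H_0 [simp]: "H 0 \<theta> = 1"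
  by (simp add: H_def)

lemma H_nonzero: "cmod a < 1 \<Longrightarrow> H a \<theta> \<noteq> 0"
  by (simp add: H_def Q_nonzero norm_mult)

lemma H_continuous [continuous_intros]: "continuous_on A (H a)"
  unfolding H_def by (intro continuous_intros)

lemma w_continuous [continuous_intros]: "continuous_on A w"
  unfolding w_def H_def by (intro continuous_intros)

lemma H_shift: "H a \<theta> = (1 - a * (cis \<theta> + cis (- \<theta>)) + a\<^sup>2) * H (a * q) \<theta>"
proof -
  have "cis \<theta> * cis (- \<theta>) = 1"
    by (simp add: cis_mult)
  then have "(1 - a * cis \<theta>) * (1 - a * cis (- \<theta>)) = 1 - a * (cis \<theta> + cis (- \<theta>)) + a\<^sup>2"
    by algebra
  then show ?thesis
    using Q_shift[of "a * cis \<theta>"] Q_shift[of "a * cis (- \<theta>)"]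
    by (simp add: H_def mult_ac)
qed

text \<open>
Multiplying the integrand by $1-2bx+b^2$, where $x=\cos\theta$, replaces \<open>b\<close> by \<open>bq\<close>, and
$$c(1-2bx+b^2)-b(1-2cx+c^2)=(c-b)(1-bc)$$ is free of $x$.
\<close>

lemma contiguous_integral:
  assumes g: "continuous_on {0..pi} g" and b: "cmod b < 1" and c: "cmod c < 1"
  shows "(c - b) * (1 - b * c) * integral {0..pi} (\<lambda>\<theta>. g \<theta> / (H b \<theta> * H c \<theta>)) =
    c * integral {0..pi} (\<lambda>\<theta>. g \<theta> / (H (b * q) \<theta> * H c \<theta>))
    - b * integral {0..pi} (\<lambda>\<theta>. g \<theta> / (H b \<theta> * H (c * q) \<theta>))"
proof -
  have bq: "cmod (b * q) < 1" and cq: "cmod (c * q) < 1"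
    using b c norm_mult_q_le le_less_trans by blast+
  have int: "(\<lambda>\<theta>. g \<theta> / (H x \<theta> * H y \<theta>)) integrable_on {0..pi}"
    if "cmod x < 1" "cmod y < 1" for x y
    using that by (intro integrable_continuous_real continuous_intros g) (simp add: H_nonzero)
  have point: "(c - b) * (1 - b * c) * (g \<theta> / (H b \<theta> * H c \<theta>)) =
      c * (g \<theta> / (H (b * q) \<theta> * H c \<theta>)) - b * (g \<theta> / (H b \<theta> * H (c * q) \<theta>))" for \<theta>
  proof -
    have nz: "H b \<theta> \<noteq> 0" "H c \<theta> \<noteq> 0" "H (b * q) \<theta> \<noteq> 0" "H (c * q) \<theta> \<noteq> 0"
      using b c bq cq by (simp_all add: H_nonzero)
    define x where "x = cis \<theta> + cis (- \<theta>)"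
    have 1: "1 / H (b * q) \<theta> = (1 - b * x + b\<^sup>2) / H b \<theta>"
      and 2: "1 / H (c * q) \<theta> = (1 - c * x + c\<^sup>2) / H c \<theta>"
      using nz by (simp_all add: H_shift[of b] H_shift[of c] x_def)
    have "c * (g \<theta> / (H (b * q) \<theta> * H c \<theta>)) - b * (g \<theta> / (H b \<theta> * H (c * q) \<theta>)) =
        c * g \<theta> * (1 / H (b * q) \<theta>) / H c \<theta> - b * g \<theta> * (1 / H (c * q) \<theta>) / H b \<theta>"
      by simp
    also have "\<dots> = (c * (1 - b * x + b\<^sup>2) - b * (1 - c * x + c\<^sup>2)) * (g \<theta> / (H b \<theta> * H c \<theta>))"
      unfolding 1 2 using nz by (simp add: field_simps)
    also have "c * (1 - b * x + b\<^sup>2) - b * (1 - c * x + c\<^sup>2) = (c - b) * (1 - b * c)"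
      by algebra
    finally show ?thesis
      by simp
  qed
  have "(c - b) * (1 - b * c) * integral {0..pi} (\<lambda>\<theta>. g \<theta> / (H b \<theta> * H c \<theta>)) =
      integral {0..pi} (\<lambda>\<theta>. (c - b) * (1 - b * c) * (g \<theta> / (H b \<theta> * H c \<theta>)))"
    by (rule integral_mult_right[symmetric])
  also have "\<dots> = integral {0..pi} (\<lambda>\<theta>. c * (g \<theta> / (H (b * q) \<theta> * H c \<theta>))
      - b * (g \<theta> / (H b \<theta> * H (c * q) \<theta>)))"
    by (simp only: point)
  also have "\<dots> = integral {0..pi} (\<lambda>\<theta>. c * (g \<theta> / (H (b * q) \<theta> * H c \<theta>)))
      - integral {0..pi} (\<lambda>\<theta>. b * (g \<theta> / (H b \<theta> * H (c * q) \<theta>)))"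
    by (intro integral_diff integrable_on_mult_right int b c bq cq)
  finally show ?thesis
    by (simp only: integral_mult_right)
qed

text \<open>
This and the contiguous relation are the two properties of the integrals that
\<open>contiguous_unique\<close> needs.
\<close>

lemma integral_holomorphic:
  assumes g: "continuous_on {0..pi} g"
  shows "(\<lambda>b. integral {0..pi} (\<lambda>\<theta>. g \<theta> / H b \<theta>)) holomorphic_on ball 0 1"
proof -
  define H' where "H' b \<theta> = cis \<theta> * deriv Q (b * cis \<theta>) * Q (b * cis (- \<theta>))
    + Q (b * cis \<theta>) * (cis (- \<theta>) * deriv Q (b * cis (- \<theta>)))" for b \<theta>
  have Q': "((\<lambda>b. Q (b * u)) has_field_derivative u * deriv Q (b * u)) (at b within A)" for u b A
  proof -
    have "((\<lambda>b. Q (b * u)) has_field_derivative deriv Q (b * u) * u) (at b within A)"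
      by (rule DERIV_chain2[OF Q_has_field_derivative]) (auto intro!: derivative_eq_intros)
    then show ?thesis
      by (simp add: mult.commute)
  qed
  have H': "((\<lambda>b. H b \<theta>) has_field_derivative H' b \<theta>) (at b within A)" for b \<theta> A
    unfolding H_def H'_def by (auto intro!: derivative_eq_intros Q')
  have "(\<lambda>b. integral (cbox 0 pi) (\<lambda>\<theta>. g \<theta> / H b \<theta>)) holomorphic_on ball 0 1"
  proof (rule leibniz_rule_holomorphic)
    fix b :: complex and t assume b: "b \<in> ball 0 1" and "t \<in> cbox 0 pi"
    show "((\<lambda>b. g t / H b t) has_field_derivative - (g t * H' b t) / (H b t * H b t))
      (at b within ball 0 1)"
      using b by (auto intro!: derivative_eq_intros H' simp: H_nonzero)
  next
    fix b :: complex assume b: "b \<in> ball 0 1"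
    then show "(\<lambda>\<theta>. g \<theta> / H b \<theta>) integrable_on cbox 0 pi"
      using g by (auto intro!: integrable_continuous_real continuous_intros simp: H_nonzero)
  next
    have "continuous_on (ball 0 1 \<times> cbox 0 pi) (\<lambda>x. g (snd x))"
      by (rule continuous_on_compose2[OF g]) (auto intro!: continuous_intros)
    then show "continuous_on (ball 0 1 \<times> cbox 0 pi) (\<lambda>(b, t). - (g t * H' b t) / (H b t * H b t))"
      unfolding case_prod_unfold H'_def H_def
      by (intro continuous_intros) (auto simp: Q_nonzero norm_mult)
  qed simp
  then show ?thesis
    by simp
qed

section \<open>Uniqueness of solutions of the contiguous relation\<close>

lemma power_series_eq_0:
  fixes e :: "nat \<Rightarrow> complex"
  assumes "\<And>b. cmod b < 1 \<Longrightarrow> (\<lambda>m. e m * b ^ m) sums 0"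
  shows "e m = 0"
proof (rule ccontr)
  assume m: "e m \<noteq> 0"
  have "e 0 = 0"
    using assms[of 0] by simp
  then have "m > 0"
    using m by (cases m) auto
  show False
  proof (rule powser_0_nonzero[of 1 0 e "\<lambda>_. 0" m])
    show "(\<lambda>n. e n * (x - 0) ^ n) sums 0" if "norm (x - 0) < 1" for x
      using assms[of x] that by simp
  next
    fix s :: real
    assume s: "0 < s" "\<And>z :: complex. z \<in> cball 0 s - {0} \<Longrightarrow> (0 :: complex) \<noteq> 0"
    have "complex_of_real s \<in> cball 0 s - {0}"
      using s(1) by simp
    then show False
      using s(2) by blast
  qed (use m \<open>m > 0\<close> in simp_all)
qed

text \<open>
The factor $(bc;q)_\infty$ absorbs $1-bc$: for $F(b,c)=(bc;q)_\infty D(b,c)$ the relation becomes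
$(c-b)F(b,c)=cF(bq,c)-bF(b,cq)$. Its coefficient of $b^{m+1}$ reads
$$c(1-q^{m+1})f_{m+1}(c)=f_m(c)-f_m(cq),$$
where $f_m(c)$ is the coefficient of $b^m$ in $F(b,c)$. Hence all coefficients vanish, by
induction on $m$ from $f_0=0$.
\<close>

lemma contiguous_unique:
  fixes D :: "complex \<Rightarrow> complex \<Rightarrow> complex"
  assumes holo: "\<And>c. 0 < cmod c \<Longrightarrow> cmod c < 1 \<Longrightarrow> (\<lambda>b. D b c) holomorphic_on ball 0 1"
    and zero: "\<And>c. 0 < cmod c \<Longrightarrow> cmod c < 1 \<Longrightarrow> D 0 c = 0"
    and rel: "\<And>b c. cmod b < 1 \<Longrightarrow> 0 < cmod c \<Longrightarrow> cmod c < 1 \<Longrightarrow>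
      (c - b) * (1 - b * c) * D b c = c * D (b * q) c - b * D b (c * q)"
    and b: "cmod b < 1" and c: "0 < cmod c" "cmod c < 1"
  shows "D b c = 0"
proof -
  define F where "F b c = Q (b * c) * D b c" for b c
  define f where "f c m = (deriv ^^ m) (\<lambda>b. F b c) 0 / fact m" for c m
  have c_q: "0 < cmod (c * q)" "cmod (c * q) < 1" if "0 < cmod c" "cmod c < 1" for c
    using that q_nonzero norm_mult_q_le[of c] by auto
  have F_sums: "(\<lambda>m. f c m * b ^ m) sums F b c" if "cmod b < 1" "0 < cmod c" "cmod c < 1" for b c
  proof -
    have "(\<lambda>b. F b c) holomorphic_on ball 0 1"
      unfolding F_def using that by (intro holomorphic_intros holo)
    then show ?thesis
      using holomorphic_power_series[of "\<lambda>b. F b c" 0 1 b] that by (simp add: f_def)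
  qed
  have F_rel: "(c - b) * F b c = c * F (b * q) c - b * F b (c * q)"
    if "cmod b < 1" "0 < cmod c" "cmod c < 1" for b c
  proof -
    have "(c - b) * F b c = Q (b * c * q) * ((c - b) * (1 - b * c) * D b c)"
      using Q_shift[of "b * c"] by (simp add: F_def)
    also have "\<dots> = c * F (b * q) c - b * F b (c * q)"
      unfolding rel[OF that] F_def by (simp add: algebra_simps)
    finally show ?thesis .
  qed
  have f_zero: "f c m = 0" if "0 < cmod c" "cmod c < 1" for c m
    using that
  proof (induction m arbitrary: c)
    case 0
    then show ?case
      by (simp add: f_def F_def zero)
  next
    case (Suc m)
    note c = Suc.prems
    \<comment> \<open>The coefficient of $b^k$ in $cF(b,c)-cF(bq,c)-bF(b,c)+bF(b,cq)$.\<close>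
    define e where "e k = c * (1 - q ^ k) * f c k
      + (case k of 0 \<Rightarrow> 0 | Suc j \<Rightarrow> f (c * q) j - f c j)" for k
    have "(\<lambda>k. e k * b ^ k) sums 0" if b: "cmod b < 1" for b
    proof -
      have bq: "cmod (b * q) < 1"
        using b norm_mult_q_le[of b] by linarith
      have "(\<lambda>k. c * (f c k * b ^ k) - c * (f c k * (b * q) ^ k)) sums (c * F b c - c * F (b * q) c)"
        by (intro sums_diff sums_mult F_sums b bq c)
      then have 1: "(\<lambda>k. c * (1 - q ^ k) * f c k * b ^ k) sums (c * F b c - c * F (b * q) c)"
        by (simp add: algebra_simps power_mult_distrib)
      have "(\<lambda>j. b * (f (c * q) j * b ^ j - f c j * b ^ j)) sums (b * (F b (c * q) - F b c))"
        by (intro sums_diff sums_mult F_sums b c c_q[OF c])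
      then have "(\<lambda>j. (f (c * q) j - f c j) * b ^ Suc j) sums (b * (F b (c * q) - F b c))"
        by (simp add: algebra_simps)
      then have 2: "(\<lambda>k. (case k of 0 \<Rightarrow> 0 | Suc j \<Rightarrow> f (c * q) j - f c j) * b ^ k)
          sums (b * (F b (c * q) - F b c))"
        by (subst sums_Suc_iff[symmetric, where s = "b * (F b (c * q) - F b c)"
              and f = "\<lambda>k. (case k of 0 \<Rightarrow> 0 | Suc j \<Rightarrow> f (c * q) j - f c j) * b ^ k", simplified])
           simp
      have "c * F b c - c * F (b * q) c + b * (F b (c * q) - F b c) = 0"
        using F_rel[OF b c] by (simp add: algebra_simps)
      then show ?thesis
        using sums_add[OF 1 2] by (simp add: e_def algebra_simps)
    qed
    then have "e (Suc m) = 0"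
      by (rule power_series_eq_0)
    then have "c * (1 - q ^ Suc m) * f c (Suc m) = 0"
      using Suc.IH[OF c] Suc.IH[OF c_q[OF c]] by (simp add: e_def)
    moreover have "cmod (q ^ Suc m) < 1"
      unfolding norm_power using q_norm q_nonzero by (intro power_Suc_less_one) auto
    then have "q ^ Suc m \<noteq> 1"
      by (metis less_irrefl norm_one)
    ultimately show ?case
      using c by auto
  qed
  have "F b c = 0"
    using F_sums[OF b c] unfolding f_zero[OF c] by (simp add: sums_iff)
  moreover have "Q (b * c) \<noteq> 0"
    using b c by (intro Q_nonzero norm_mult_less_1)
  ultimately show ?thesis
    by (simp add: F_def)
qed

section \<open>The integral with one parameter\<close>

lemma odd_integral_0:
  fixes k :: "real \<Rightarrow> complex"
  assumes "\<And>t. k (- t) = - k t"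
  shows "integral {- b..b} k = 0"
proof -
  have "integral {- b..b} k = integral {- b..b} (\<lambda>t. k (- t))"
    using Henstock_Kurzweil_Integration.integral_reflect_real[of b "- b" k] by simp
  also have "\<dots> = - integral {- b..b} k"
    by (simp add: assms)
  finally show ?thesis
    by simp
qed

text \<open>
The segment from 1 to \<open>r\<close> stays away from 0 because \<open>r\<close> lies in the right half-plane. This
keeps a homotopy between two circles inside an annulus, even though it turns one circle by the
argument of \<open>r\<close>.
\<close>

lemma norm_segment_ge:
  fixes r :: complex
  assumes "0 \<le> u" "u \<le> 1" "0 \<le> Re r" "cmod r \<le> 1"
  shows "cmod r / 2 \<le> cmod (of_real (1 - u) + of_real u * r)"
proof (rule power2_le_imp_le)
  have "(1 - u) * (u * Re r) \<ge> 0"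
    using assms by simp
  then have "(1 - u)\<^sup>2 + u\<^sup>2 * (cmod r)\<^sup>2 \<le> (cmod (of_real (1 - u) + of_real u * r))\<^sup>2"
    unfolding cmod_power2 by (simp add: power2_eq_square algebra_simps)
  moreover have "(1 - u)\<^sup>2 * (cmod r)\<^sup>2 \<le> (1 - u)\<^sup>2"
    using assms by (intro mult_left_le) (simp_all add: power_le_one)
  moreover have "(cmod r)\<^sup>2 * (1 / 4) \<le> (cmod r)\<^sup>2 * ((1 - u)\<^sup>2 + u\<^sup>2)"
  proof (rule mult_left_mono)
    have "0 \<le> (2 * u - 1)\<^sup>2"
      by simp
    then show "1 / 4 \<le> (1 - u)\<^sup>2 + u\<^sup>2"
      by (simp add: power2_eq_square algebra_simps)
  qed simp
  ultimately show "(cmod r / 2)\<^sup>2 \<le> (cmod (of_real (1 - u) + of_real u * r))\<^sup>2"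
    by (simp add: power_divide algebra_simps)
qed simp

text \<open>
Let $G(z)=a(z^2,q/z^2;q)_\infty/(az,aq/z;q)_\infty$, so that the integral is, up to a constant,
that of $G$ over the unit circle. For small $a$ the circle can be moved to $z=\sqrt q\,y$ with
$|y|=1$ without meeting a zero of the denominator. There $G(z)\,dz$ is $y-1/y$ times a function
symmetric under $y\mapsto 1/y$, times $dy/y$, and the integral vanishes by symmetry.
\<close>

lemma theta_integral_0:
  assumes a: "cmod a < 1 / 2"
  shows "integral {- pi..pi} (\<lambda>\<theta>. a * Q (cis \<theta> ^ 2) * Q (q * cis (- \<theta>) ^ 2) * cis \<theta>
    / (Q (a * cis \<theta>) * Q (a * q * cis (- \<theta>)))) = 0"
proof -
  define r where "r = csqrt q"
  define G where "G z = a * Q (z\<^sup>2) * Q (q / z\<^sup>2) / (Q (a * z) * Q (a * q / z))" for z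
  define S where "S = {z. z \<noteq> 0 \<and> cmod (a * q) < cmod z \<and> cmod (a * z) < 1}"
  have r2: "r * r = q" and r_nz: "r \<noteq> 0" and Re_r: "0 \<le> Re r"
    using q_nonzero power2_csqrt[of q] csqrt_principal[of q] by (auto simp: r_def power2_eq_square)
  have r_norm2: "cmod r * cmod r = cmod q"
    using r2 by (metis norm_mult)
  have r_norm: "cmod r < 1"
    using r_norm2 q_norm by (metis norm_ge_zero abs_square_less_1 abs_of_nonneg power2_eq_square)
  have "open S"
    unfolding S_def by (intro open_Collect_conj open_Collect_less open_Collect_neq continuous_intros)
  have "G holomorphic_on S"
    unfolding G_def S_def
  proof (intro holomorphic_intros)
    fix z assume z: "z \<in> {z. z \<noteq> 0 \<and> cmod (a * q) < cmod z \<and> cmod (a * z) < 1}"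
    then have "cmod (a * q / z) < 1"
      by (auto simp: norm_divide divide_simps)
    then show "Q (a * z) * Q (a * q / z) \<noteq> 0"
      using z by (simp add: Q_nonzero)
  qed auto
  define \<gamma> where "\<gamma> = part_circlepath 0 1 (- pi) pi"
  define \<gamma>' where "\<gamma>' = part_circlepath 0 (cmod r) (- pi + Arg r) (pi + Arg r)"
  have r_polar: "of_real (cmod r) * exp (\<i> * of_real (Arg r)) = r"
    using Arg_eq[OF r_nz] by simp
  have \<gamma>': "\<gamma>' t = r * \<gamma> t" for t
  proof -
    have "linepath (- pi + Arg r) (pi + Arg r) t = linepath (- pi) pi t + Arg r"
      by (simp add: linepath_def algebra_simps)
    then have "\<gamma>' t = of_real (cmod r) * exp (\<i> * of_real (Arg r)) * \<gamma> t"
      unfolding \<gamma>_def \<gamma>'_def part_circlepath_def by (simp add: distrib_left exp_add)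
    then show ?thesis
      by (simp add: r_polar)
  qed
  have \<gamma>_norm: "cmod (\<gamma> t) = 1" for t
    by (simp add: \<gamma>_def part_circlepath_def linepath_def norm_exp_i_times
        scaleR_conv_of_real flip: of_real_mult of_real_add of_real_minus of_real_diff)
  have segment: "closed_segment (\<gamma> t) (\<gamma>' t) \<subseteq> S" for t
  proof
    fix z assume "z \<in> closed_segment (\<gamma> t) (\<gamma>' t)"
    then obtain u where u: "0 \<le> u" "u \<le> 1" "z = (1 - u) *\<^sub>R \<gamma> t + u *\<^sub>R (r * \<gamma> t)"
      by (auto simp: closed_segment_def \<gamma>')
    define p where "p = of_real (1 - u) + of_real u * r"
    have "z = p * \<gamma> t"
      using u by (simp add: p_def scaleR_conv_of_real algebra_simps)
    then have z: "cmod z = cmod p"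
      by (simp add: norm_mult \<gamma>_norm)
    have lower: "cmod r / 2 \<le> cmod p"
      unfolding p_def using u Re_r r_norm by (intro norm_segment_ge) auto
    have "cmod p \<le> (1 - u) + u * cmod r"
      unfolding p_def using u by (intro norm_triangle_le) (simp add: norm_mult del: of_real_diff)
    also have "\<dots> \<le> 1"
      using u r_norm by (simp add: mult_left_le)
    finally have upper: "cmod p \<le> 1" .
    have "cmod (a * q) = cmod a * cmod r * cmod r"
      by (simp add: norm_mult flip: r_norm2)
    also have "\<dots> \<le> cmod a * cmod r"
      using r_norm by (simp add: mult_left_le)
    also have "\<dots> < 1 / 2 * cmod r"
      using a r_nz by (intro mult_strict_right_mono) auto
    finally have "cmod (a * q) < cmod z"
      using lower z by simp
    moreover have "cmod (a * z) < 1"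
    proof -
      have "cmod (a * z) \<le> cmod a"
        using upper z by (simp add: norm_mult mult_left_le)
      then show ?thesis
        using a by simp
    qed
    moreover have "z \<noteq> 0"
      using calculation(1) norm_ge_zero[of "a * q"] by (metis leD norm_zero)
    ultimately show "z \<in> S"
      by (simp add: S_def)
  qed
  have "homotopic_loops S \<gamma> \<gamma>'"
  proof (rule homotopic_loops_linear)
    show "path \<gamma>" "path \<gamma>'"
      by (simp_all add: \<gamma>_def \<gamma>'_def)
    show "pathfinish \<gamma> = pathstart \<gamma>"
      by (simp add: \<gamma>_def exp_minus)
    then show "pathfinish \<gamma>' = pathstart \<gamma>'"
      by (simp add: pathfinish_def pathstart_def \<gamma>')
  qed (rule segment)
  then have contour: "contour_integral \<gamma> G = contour_integral \<gamma>' G"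
    by (rule Cauchy_theorem_homotopic_loops)
      (simp_all add: \<open>open S\<close> \<open>G holomorphic_on S\<close> \<gamma>_def \<gamma>'_def)
  define k where "k t = G (r * cis t) * (r * cis t)" for t
  have cis_inv: "cis (- t) = 1 / cis t" for t
    by (metis cis_inverse inverse_eq_divide)
  \<comment> \<open>The part of the integrand that is symmetric under $y\mapsto 1/y$.\<close>
  define E where "E t = a * r * (Q (q * cis t ^ 2) * Q (q * cis (- t) ^ 2))
      / (Q (a * r * cis t) * Q (a * r * cis (- t)))" for t
  have k: "k t = (cis t - cis (- t)) * E t" for t
  proof -
    have "(r * cis t)\<^sup>2 = q * cis t ^ 2" "q / (r * cis t)\<^sup>2 = cis (- t) ^ 2"
      "a * q / (r * cis t) = a * r * cis (- t)"
      using r2[symmetric] r_nz by (simp_all add: cis_inv power2_eq_square field_simps)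
    then have "k t = a * Q (q * cis t ^ 2) * Q (cis (- t) ^ 2) * (r * cis t)
        / (Q (a * r * cis t) * Q (a * r * cis (- t)))"
      by (simp add: k_def G_def mult.assoc)
    also have "Q (cis (- t) ^ 2) = (1 - cis (- t) ^ 2) * Q (q * cis (- t) ^ 2)"
      using Q_shift[of "cis (- t) ^ 2"] by (simp add: mult.commute)
    also have "a * Q (q * cis t ^ 2) * ((1 - cis (- t) ^ 2) * Q (q * cis (- t) ^ 2)) * (r * cis t)
        = a * r * ((1 - cis (- t) ^ 2) * cis t) * (Q (q * cis t ^ 2) * Q (q * cis (- t) ^ 2))"
      by (simp add: mult_ac)
    also have "(1 - cis (- t) ^ 2) * cis t = cis t - cis (- t)"
      by (simp add: cis_inv power2_eq_square field_simps)
    finally show ?thesis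
      by (simp add: E_def mult_ac)
  qed
  have "E (- t) = E t" for t
    by (simp add: E_def mult.commute)
  then have "k (- t) = - k t" for t
    by (simp add: k left_diff_distrib)
  then have k_0: "integral {- pi..pi} k = 0"
    by (rule odd_integral_0)
  have "contour_integral \<gamma>' G = integral {- pi + Arg r..pi + Arg r}
      (\<lambda>t. G (of_real (cmod r) * cis t) * of_real (cmod r) * \<i> * cis t)"
    unfolding \<gamma>'_def by (subst contour_integral_part_circlepath_eq) auto
  also have "\<dots> = integral {- pi..pi}
      (\<lambda>t. G (of_real (cmod r) * cis (t + Arg r)) * of_real (cmod r) * \<i> * cis (t + Arg r))"
    using integral_shift_real_ivl[of "- pi + Arg r" "Arg r" "pi + Arg r",
        where f = "\<lambda>t. G (of_real (cmod r) * cis t) * of_real (cmod r) * \<i> * cis t"] by simp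
  also have "\<dots> = integral {- pi..pi} (\<lambda>t. \<i> * k t)"
  proof (rule arg_cong[where f = "integral {- pi..pi}"], rule ext)
    fix t
    have *: "of_real (cmod r) * cis (t + Arg r) = r * cis t"
      using r_polar by (simp add: cis_conv_exp exp_add algebra_simps)
    have "G (of_real (cmod r) * cis (t + Arg r)) * of_real (cmod r) * \<i> * cis (t + Arg r)
        = G (of_real (cmod r) * cis (t + Arg r)) * \<i> * (of_real (cmod r) * cis (t + Arg r))"
      by simp
    then show "G (of_real (cmod r) * cis (t + Arg r)) * of_real (cmod r) * \<i> * cis (t + Arg r)
        = \<i> * k t"
      unfolding * by (simp add: k_def)
  qed
  finally have "contour_integral \<gamma>' G = 0"
    using k_0 by simp
  then have "contour_integral \<gamma> G = 0"
    by (simp add: contour)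
  moreover have "contour_integral \<gamma> G = integral {- pi..pi} (\<lambda>t. G (cis t) * \<i> * cis t)"
    unfolding \<gamma>_def by (subst contour_integral_part_circlepath_eq) auto
  moreover have "(\<lambda>t. G (cis t) * \<i> * cis t) = (\<lambda>t. \<i> * (a * Q (cis t ^ 2) * Q (q * cis (- t) ^ 2) * cis t
    / (Q (a * cis t) * Q (a * q * cis (- t)))))"
    by (rule ext) (simp add: G_def cis_inv power_one_over)
  ultimately have "\<i> * integral {- pi..pi} (\<lambda>t. a * Q (cis t ^ 2) * Q (q * cis (- t) ^ 2) * cis t
    / (Q (a * cis t) * Q (a * q * cis (- t)))) = 0"
    by (simp only: integral_mult_right)
  then show ?thesis
    by simp
qed


text \<open>
The difference of the integrands for \<open>a\<close> and \<open>aq\<close> is $w/h(a)$ times $az+a/z-a^2$, and the weight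
contains the factor $(1-z^2)(1-z^{-2})$. Because
$$(1-z^2)(1-z^{-2})(z+1/z-a)=(1-z^2)(z-a)+(1-z^{-2})(1/z-a),$$
the difference is the symmetrization of the integrand of \<open>theta_integral_0\<close>.
\<close>

lemma w_over_H_difference:
  assumes a: "cmod a < 1"
  defines "f \<equiv> \<lambda>\<theta>. a * Q (cis \<theta> ^ 2) * Q (q * cis (- \<theta>) ^ 2) * cis \<theta>
    / (Q (a * cis \<theta>) * Q (a * q * cis (- \<theta>)))"
  shows "w \<theta> / H a \<theta> - w \<theta> / H (a * q) \<theta> = f \<theta> + f (- \<theta>)"
proof -
  define z where "z = cis \<theta>"
  define y where "y = cis (- \<theta>)"
  have zy: "z * y = 1"
    by (simp add: z_def y_def cis_mult)
  have nz: "Q (a * z) \<noteq> 0" "Q (a * y) \<noteq> 0" "Q (a * q * z) \<noteq> 0" "Q (a * q * y) \<noteq> 0"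
    using a norm_mult_q_le[of a] by (auto intro!: Q_nonzero simp: z_def y_def norm_mult)
  have shift: "Q (a * z) = (1 - a * z) * Q (a * q * z)" "Q (a * y) = (1 - a * y) * Q (a * q * y)"
    "Q (z\<^sup>2) = (1 - z\<^sup>2) * Q (q * z\<^sup>2)" "Q (y\<^sup>2) = (1 - y\<^sup>2) * Q (q * y\<^sup>2)"
    using Q_shift[of "a * z"] Q_shift[of "a * y"] Q_shift[of "z\<^sup>2"] Q_shift[of "y\<^sup>2"]
    by (simp_all add: mult_ac)
  define P where "P = Q (q * z\<^sup>2) * Q (q * y\<^sup>2)"
  have w: "w \<theta> = (1 - z\<^sup>2) * (1 - y\<^sup>2) * P"
    using shift(3,4) by (simp add: w_def H_def z_def y_def P_def Complex.DeMoivre mult_ac)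
  have H: "H a \<theta> = Q (a * z) * Q (a * y)" "H (a * q) \<theta> = Q (a * q * z) * Q (a * q * y)"
    by (simp_all add: H_def z_def y_def)
  have f1: "f \<theta> = a * (1 - z\<^sup>2) * (1 - a * y) * z * P / H a \<theta>"
  proof -
    have "f \<theta> = a * ((1 - z\<^sup>2) * Q (q * z\<^sup>2)) * Q (q * y\<^sup>2) * z / (Q (a * z) * Q (a * q * y))"
      unfolding f_def z_def[symmetric] y_def[symmetric] shift(3) ..
    also have "\<dots> = a * (1 - z\<^sup>2) * (1 - a * y) * z * P / (Q (a * z) * ((1 - a * y) * Q (a * q * y)))"
      using nz shift(2) by (simp add: P_def)
    finally show ?thesis
      by (simp only: H shift(2))
  qed
  have f2: "f (- \<theta>) = a * (1 - y\<^sup>2) * (1 - a * z) * y * P / H a \<theta>"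
  proof -
    have "f (- \<theta>) = a * ((1 - y\<^sup>2) * Q (q * y\<^sup>2)) * Q (q * z\<^sup>2) * y / (Q (a * y) * Q (a * q * z))"
      unfolding f_def minus_minus z_def[symmetric] y_def[symmetric] shift(4) ..
    also have "\<dots> = a * (1 - y\<^sup>2) * (1 - a * z) * y * P / (Q (a * y) * ((1 - a * z) * Q (a * q * z)))"
      using nz shift(1) by (simp add: P_def)
    finally show ?thesis
      by (simp only: H shift(1) mult.commute[of "Q (a * y)"])
  qed
  have "H a \<theta> = (1 - a * z) * (1 - a * y) * H (a * q) \<theta>"
    unfolding H shift(1,2) by simp
  then have "1 / H (a * q) \<theta> = (1 - a * z) * (1 - a * y) / H a \<theta>"
    using nz shift(1,2) by auto
  then have "w \<theta> / H (a * q) \<theta> = w \<theta> * ((1 - a * z) * (1 - a * y)) / H a \<theta>"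
    by (metis mult.right_neutral times_divide_eq_right)
  then have "w \<theta> / H a \<theta> - w \<theta> / H (a * q) \<theta> = w \<theta> * (1 - (1 - a * z) * (1 - a * y)) / H a \<theta>"
    by (metis diff_divide_distrib mult.right_neutral right_diff_distrib)
  also have "w \<theta> * (1 - (1 - a * z) * (1 - a * y)) =
      a * (1 - z\<^sup>2) * (1 - a * y) * z * P + a * (1 - y\<^sup>2) * (1 - a * z) * y * P"
    unfolding w using zy by algebra
  finally show ?thesis
    unfolding f1 f2 by (simp add: add_divide_distrib)
qed

lemma total_mass_shift:
  assumes a: "cmod a < 1 / 2"
  shows "integral {0..pi} (\<lambda>\<theta>. w \<theta> / H a \<theta>) = integral {0..pi} (\<lambda>\<theta>. w \<theta> / H (a * q) \<theta>)"
proof -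
  define f where "f = (\<lambda>\<theta>. a * Q (cis \<theta> ^ 2) * Q (q * cis (- \<theta>) ^ 2) * cis \<theta>
    / (Q (a * cis \<theta>) * Q (a * q * cis (- \<theta>))))"
  have a1: "cmod a < 1" "cmod (a * q) < 1"
    using a norm_mult_q_le[of a] by linarith+
  have "continuous_on A f" for A
    unfolding f_def using a1 by (intro continuous_intros) (auto simp: Q_nonzero norm_mult)
  then have f: "f integrable_on {x..y}" for x y
    by (intro integrable_continuous_real)
  have fm: "(\<lambda>\<theta>. f (- \<theta>)) integrable_on {0..pi}"
    using f[of "- pi" 0] Henstock_Kurzweil_Integration.integrable_reflect_real[of f 0 "- pi"] by simp
  have w: "(\<lambda>\<theta>. w \<theta> / H x \<theta>) integrable_on {0..pi}" if "cmod x < 1" for x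
    using that by (intro integrable_continuous_real continuous_intros) (simp add: H_nonzero)
  have "integral {0..pi} (\<lambda>\<theta>. w \<theta> / H a \<theta>) - integral {0..pi} (\<lambda>\<theta>. w \<theta> / H (a * q) \<theta>)
      = integral {0..pi} (\<lambda>\<theta>. w \<theta> / H a \<theta> - w \<theta> / H (a * q) \<theta>)"
    by (rule integral_diff[symmetric]) (intro w a1)+
  also have "\<dots> = integral {0..pi} (\<lambda>\<theta>. f \<theta> + f (- \<theta>))"
    unfolding f_def by (simp only: w_over_H_difference[OF a1(1)])
  also have "\<dots> = integral {0..pi} f + integral {0..pi} (\<lambda>\<theta>. f (- \<theta>))"
    by (rule integral_add[OF f fm])
  also have "integral {0..pi} (\<lambda>\<theta>. f (- \<theta>)) = integral {- pi..0} f"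
    using Henstock_Kurzweil_Integration.integral_reflect_real[of 0 "- pi" f] by simp
  also have "integral {0..pi} f + integral {- pi..0} f = integral {- pi..pi} f"
    using Henstock_Kurzweil_Integration.integral_combine[of "- pi" 0 pi f] f by (simp add: add.commute)
  also have "\<dots> = 0"
    unfolding f_def by (rule theta_integral_0[OF a])
  finally show ?thesis
    by simp
qed

text \<open>
Near 0 the integral is invariant under \<open>a \<mapsto> aq\<close>, hence equal to its value at the limit 0 of
$aq^n$; elsewhere the identity theorem applies.
\<close>

lemma total_mass_constant:
  assumes a: "cmod a < 1"
  shows "integral {0..pi} (\<lambda>\<theta>. w \<theta> / H a \<theta>) = integral {0..pi} w"
proof -
  define K where "K = (\<lambda>a. integral {0..pi} (\<lambda>\<theta>. w \<theta> / H a \<theta>))"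
  have holo: "K holomorphic_on ball 0 1"
    unfolding K_def by (intro integral_holomorphic continuous_intros)
  have K0: "K 0 = integral {0..pi} w"
    by (simp add: K_def)
  have near: "K x = K 0" if x: "cmod x < 1 / 2" for x
  proof -
    have "cmod (x * q ^ n) < 1 / 2" for n
      using x norm_mult_q_power_le[of x n] by linarith
    then have "K (x * q ^ Suc n) = K (x * q ^ n)" for n
      using total_mass_shift[of "x * q ^ n"] by (simp add: K_def mult_ac)
    then have const: "K (x * q ^ n) = K x" for n
      by (induction n) simp_all
    have "(\<lambda>n. x * q ^ n) \<longlonglongrightarrow> x * 0"
      using q_norm by (intro tendsto_intros LIMSEQ_power_zero)
    moreover have "isCont K 0"
      using holomorphic_on_imp_continuous_on[OF holo] by (simp add: continuous_on_eq_continuous_at)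
    ultimately have "(\<lambda>n. K (x * q ^ n)) \<longlonglongrightarrow> K 0"
      using isCont_tendsto_compose[of 0 K] by simp
    then show ?thesis
      by (simp add: const LIMSEQ_const_iff)
  qed
  have "K a = K 0"
  proof (rule analytic_continuation_open[where f = K and g = "\<lambda>_. K 0"])
    show "open (ball 0 (1 / 2) :: complex set)" "open (ball 0 1 :: complex set)"
      "connected (ball 0 1 :: complex set)"
      by simp_all
    show "ball 0 (1 / 2) \<noteq> ({} :: complex set)" "ball 0 (1 / 2) \<subseteq> (ball 0 1 :: complex set)"
      by (simp_all add: subset_ball)
    show "K holomorphic_on ball 0 1" "(\<lambda>_. K 0) holomorphic_on ball 0 1"
      by (intro holo holomorphic_intros)+
    show "K z = K 0" if "z \<in> ball 0 (1 / 2)" for z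
      by (rule near) (use that in simp)
    show "a \<in> ball 0 1"
      using a by simp
  qed
  then show ?thesis
    by (simp add: K_def K0)
qed

section \<open>The Askey--Wilson integral\<close>

definition askey_wilson :: "complex \<Rightarrow> complex \<Rightarrow> complex \<Rightarrow> complex \<Rightarrow> complex" where
  "askey_wilson a b c d = Q (a * b * c * d) /
     (Q (a * b) * Q (a * c) * Q (a * d) * Q (b * c) * Q (b * d) * Q (c * d))"

lemma askey_integral_contiguous:
  assumes "cmod a < 1" "cmod b < 1" "cmod c < 1" "cmod d < 1" "cmod s < 1"
  shows "(b - a) * (1 - a * b) * askey_integral a b c d s =
    b * askey_integral (a * q) b c d s - a * askey_integral a (b * q) c d s"
proof -
  have "continuous_on {0..pi} (\<lambda>\<theta>. w \<theta> / (H c \<theta> * H d \<theta> * H s \<theta>))"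
    using assms by (intro continuous_intros) (simp add: H_nonzero)
  from contiguous_integral[OF this assms(1,2)] show ?thesis
    by (simp add: askey_integral_def divide_divide_eq_left' mult_ac)
qed

lemma askey_integral_holomorphic:
  assumes "cmod b < 1" "cmod c < 1" "cmod d < 1" "cmod s < 1"
  shows "(\<lambda>a. askey_integral a b c d s) holomorphic_on ball 0 1"
proof -
  have "continuous_on {0..pi} (\<lambda>\<theta>. w \<theta> / (H b \<theta> * H c \<theta> * H d \<theta> * H s \<theta>))"
    using assms by (intro continuous_intros) (simp add: H_nonzero)
  from integral_holomorphic[OF this] show ?thesis
    by (simp add: askey_integral_def divide_divide_eq_left' mult_ac)
qed

lemma askey_integral_commute:
  "askey_integral a b c d s = askey_integral b a c d s"
  "askey_integral a b c d s = askey_integral a c b d s"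
  "askey_integral a b c d s = askey_integral a b d c s"
  "askey_integral a b c d s = askey_integral a b c s d"
  unfolding askey_integral_def by (simp_all only: mult_ac)

lemma askey_wilson_commute: "askey_wilson a b c d = askey_wilson b a c d"
  by (simp add: askey_wilson_def mult_ac)

lemma askey_wilson_contiguous:
  assumes a: "cmod a < 1" and b: "cmod b < 1" and c: "cmod c < 1" and d: "cmod d < 1"
  shows "(b - a) * (1 - a * b) * askey_wilson a b c d =
    b * askey_wilson (a * q) b c d - a * askey_wilson a (b * q) c d"
proof -
  note less = norm_mult_less_1
  have nz: "Q (a * b * q) \<noteq> 0" "Q (a * c) \<noteq> 0" "Q (a * d) \<noteq> 0" "Q (b * c) \<noteq> 0"
      "Q (b * d) \<noteq> 0" "Q (c * d) \<noteq> 0" "Q (a * b) \<noteq> 0"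
    "1 - a * b \<noteq> 0" "1 - a * c \<noteq> 0" "1 - a * d \<noteq> 0" "1 - b * c \<noteq> 0" "1 - b * d \<noteq> 0"
    by (intro Q_nonzero one_minus_nonzero less q_norm a b c d)+
  define P where "P = Q (a * b * c * d * q) /
     (Q (a * b * q) * Q (a * c) * Q (a * d) * Q (b * c) * Q (b * d) * Q (c * d))"
  have 0: "(1 - a * b) * askey_wilson a b c d = (1 - a * b * c * d) * P"
    unfolding askey_wilson_def P_def Q_shift[of "a * b * c * d"] Q_shift[of "a * b"] using nz by simp
  have "askey_wilson (a * q) b c d = Q (a * b * c * d * q) /
     (Q (a * b * q) * Q (a * c * q) * Q (a * d * q) * Q (b * c) * Q (b * d) * Q (c * d))"
    by (simp add: askey_wilson_def mult_ac)
  then have 1: "askey_wilson (a * q) b c d = (1 - a * c) * (1 - a * d) * P"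
    unfolding P_def Q_shift[of "a * c"] Q_shift[of "a * d"] using nz by simp
  have "askey_wilson a (b * q) c d = Q (a * b * c * d * q) /
     (Q (a * b * q) * Q (a * c) * Q (a * d) * Q (b * c * q) * Q (b * d * q) * Q (c * d))"
    by (simp add: askey_wilson_def mult_ac)
  then have 2: "askey_wilson a (b * q) c d = (1 - b * c) * (1 - b * d) * P"
    unfolding P_def Q_shift[of "b * c"] Q_shift[of "b * d"] using nz by simp
  show ?thesis
    unfolding 1 2 mult.assoc[of "b - a"] 0 by algebra
qed

text \<open>
Both sides satisfy the same contiguous relation in \<open>a\<close> and \<open>b\<close>, so that they agree as soon as they
agree at \<open>a = 0\<close>. There one parameter fewer is left.
\<close>

lemma askey_wilson_step:
  assumes c: "cmod c < 1" and d: "cmod d < 1"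
    and zero: "\<And>b. cmod b < 1 \<Longrightarrow> askey_integral 0 b c d 0 = K * askey_wilson 0 b c d"
    and a: "cmod a < 1" and b: "cmod b < 1"
  shows "askey_integral a b c d 0 = K * askey_wilson a b c d"
proof (cases "b = 0")
  case True
  then show ?thesis
    using zero[OF a] askey_integral_commute(1)[of a 0] askey_wilson_commute[of a 0] by simp
next
  case False
  define D where "D a b = askey_integral a b c d 0 - K * askey_wilson a b c d" for a b
  have "D a b = 0"
  proof (rule contiguous_unique[where D = D])
    fix b :: complex assume b: "0 < cmod b" "cmod b < 1"
    have "(\<lambda>a. askey_wilson a b c d) holomorphic_on ball 0 1"
      unfolding askey_wilson_def using b c d
      by (intro holomorphic_intros) (auto intro!: Q_nonzero norm_mult_less_1)
    then show "(\<lambda>a. D a b) holomorphic_on ball 0 1"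
      unfolding D_def using b c d by (intro holomorphic_intros askey_integral_holomorphic) auto
    show "D 0 b = 0"
      using zero b by (simp add: D_def)
  next
    fix a b :: complex assume "cmod a < 1" "0 < cmod b" "cmod b < 1"
    then show "(b - a) * (1 - a * b) * D a b = b * D (a * q) b - a * D a (b * q)"
      using askey_integral_contiguous[of a b c d 0] askey_wilson_contiguous[of a b c d] c d
      by (simp add: D_def right_diff_distrib mult.left_commute[of _ K])
  qed (use a b False in auto)
  then show ?thesis
    by (simp add: D_def)
qed

lemma askey_wilson_integral_up_to_constant:
  assumes a: "cmod a < 1" and b: "cmod b < 1" and c: "cmod c < 1" and d: "cmod d < 1"
  shows "askey_integral a b c d 0 = integral {0..pi} w * askey_wilson a b c d"
proof -
  let ?K = "integral {0..pi} w"
  have 1: "askey_integral 0 b 0 0 0 = ?K * askey_wilson 0 b 0 0" if "cmod b < 1" for b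
    using total_mass_constant[OF that] by (simp add: askey_integral_def askey_wilson_def)
  have 2: "askey_integral 0 b c 0 0 = ?K * askey_wilson 0 b c 0" if "cmod b < 1" "cmod c < 1" for b c
  proof -
    have "askey_integral b c 0 0 0 = ?K * askey_wilson b c 0 0"
      by (rule askey_wilson_step[OF _ _ 1]) (use that in simp_all)
    moreover have "askey_integral 0 b c 0 0 = askey_integral b c 0 0 0"
      by (simp add: askey_integral_def)
    moreover have "askey_wilson 0 b c 0 = askey_wilson b c 0 0"
      by (simp add: askey_wilson_def)
    ultimately show ?thesis
      by simp
  qed
  have 3: "askey_integral 0 b c d 0 = ?K * askey_wilson 0 b c d"
    if "cmod b < 1" "cmod c < 1" "cmod d < 1" for b c d
  proof -
    have "askey_integral b c d 0 0 = ?K * askey_wilson b c d 0"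
      by (rule askey_wilson_step[OF _ _ 2]) (use that in simp_all)
    moreover have "askey_integral 0 b c d 0 = askey_integral b c d 0 0"
      by (simp add: askey_integral_def mult_ac)
    moreover have "askey_wilson 0 b c d = askey_wilson b c d 0"
      by (simp add: askey_wilson_def mult_ac)
    ultimately show ?thesis
      by simp
  qed
  show ?thesis
    by (rule askey_wilson_step[OF _ _ 3]) (use a b c d in simp_all)
qed

text \<open>
Split the factors of $(qx^2;q)_\infty$ according to the parity of the exponent and factor each as a
difference of squares.
\<close>

lemma Q_duplication:
  assumes r: "r\<^sup>2 = q"
  shows "Q (q * x\<^sup>2) = Q (q * x) * Q (- q * x) * Q (r * x) * Q (- r * x)"
proof (rule LIMSEQ_unique)
  have split: "qpoch q (q * x\<^sup>2) (2 * n)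
      = qpoch q (q * x) n * qpoch q (- q * x) n * qpoch q (r * x) n * qpoch q (- r * x) n" for n
  proof (induction n)
    case (Suc n)
    have "(1 - q * x\<^sup>2 * q ^ (2 * n)) * (1 - q * x\<^sup>2 * q ^ Suc (2 * n)) =
        (1 - q * x * q ^ n) * (1 - - q * x * q ^ n) * ((1 - r * x * q ^ n) * (1 - - r * x * q ^ n))"
    proof -
      define y where "y = q ^ n"
      have y: "q ^ (2 * n) = y\<^sup>2"
        by (simp add: y_def power_mult[symmetric] mult.commute)
      show ?thesis
        unfolding power_Suc y y_def[symmetric] unfolding r[symmetric]
        by (simp add: algebra_simps power2_eq_square)
    qed
    then show ?case
      using Suc.IH by (simp add: qpoch_Suc mult_ac)
  qed simp
  have "(\<lambda>n. qpoch q (q * x\<^sup>2) (2 * n)) \<longlonglongrightarrow> Q (q * x\<^sup>2)"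
    using LIMSEQ_subseq_LIMSEQ[OF qpoch_LIMSEQ, of "\<lambda>n. 2 * n"] by (simp add: strict_mono_def o_def)
  then show "(\<lambda>n. qpoch q (q * x) n * qpoch q (- q * x) n * qpoch q (r * x) n * qpoch q (- r * x) n)
      \<longlonglongrightarrow> Q (q * x\<^sup>2)"
    by (simp only: split)
qed (intro tendsto_intros qpoch_LIMSEQ)

text \<open>
The constant comes from a case in which the integral is elementary: at the parameters
$q,-q,\sqrt q,-\sqrt q$ the denominator cancels all of the weight but
$(1-z^2)(1-z^{-2})=2-2\cos 2\theta$.
\<close>

lemma integral_w: "integral {0..pi} w = 2 * of_real pi / Q q"
proof -
  define r where "r = csqrt q"
  have r2: "r\<^sup>2 = q"
    by (simp add: r_def)
  have r_norm: "cmod r < 1"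
    using q_norm r2 by (metis norm_power norm_ge_zero abs_square_less_1 abs_of_nonneg)
  have H: "H 1 (2 * \<theta>) = (2 - 2 * of_real (cos (2 * \<theta>))) * (H q \<theta> * H (- q) \<theta> * H r \<theta> * H (- r) \<theta>)"
    for \<theta>
  proof -
    have "H 1 (2 * \<theta>) = ((1 - cis \<theta> ^ 2) * Q (q * cis \<theta> ^ 2)) * ((1 - cis (- \<theta>) ^ 2) * Q (q * cis (- \<theta>) ^ 2))"
      using Q_shift[of "cis \<theta> ^ 2"] Q_shift[of "cis (- \<theta>) ^ 2"]
      by (simp add: H_def Complex.DeMoivre mult.commute)
    also have "\<dots> = (1 - cis \<theta> ^ 2) * (1 - cis (- \<theta>) ^ 2) * (H q \<theta> * H (- q) \<theta> * H r \<theta> * H (- r) \<theta>)"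
      unfolding Q_duplication[OF r2] H_def by (simp add: mult_ac)
    also have "(1 - cis \<theta> ^ 2) * (1 - cis (- \<theta>) ^ 2) = 2 - 2 * of_real (cos (2 * \<theta>))"
      by (simp add: Complex.DeMoivre algebra_simps cis_mult) (simp add: complex_eq_iff)
    finally show ?thesis .
  qed
  have "askey_integral q (- q) r (- r) 0 = integral {0..pi} (\<lambda>\<theta>. of_real (2 - 2 * cos (2 * \<theta>)))"
    unfolding askey_integral_def w_def using q_norm r_norm
    by (simp add: H H_nonzero)
  also have "\<dots> = of_real (2 * pi)"
  proof -
    have "((\<lambda>\<theta>. 2 - 2 * cos (2 * \<theta>)) has_integral (2 * pi - sin (2 * pi)) - (2 * 0 - sin (2 * 0))) {0..pi}"
      by (intro fundamental_theorem_of_calculus)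
        (auto intro!: derivative_eq_intros simp: has_real_derivative_iff_has_vector_derivative[symmetric])
    then have "((\<lambda>\<theta>. of_real (2 - 2 * cos (2 * \<theta>)) :: complex) has_integral of_real (2 * pi)) {0..pi}"
      by (intro has_integral_of_real) simp
    then show ?thesis
      by (rule integral_unique)
  qed
  finally have 1: "2 * of_real pi = integral {0..pi} w * askey_wilson q (- q) r (- r)"
    using askey_wilson_integral_up_to_constant[of q "- q" r "- r"] q_norm r_norm by simp
  have nz: "Q q \<noteq> 0" "Q (- q) \<noteq> 0" "Q r \<noteq> 0" "Q (- r) \<noteq> 0" "1 - q \<noteq> 0" "1 + q \<noteq> 0"
    "1 - r \<noteq> 0" "1 + r \<noteq> 0" "1 - q * q \<noteq> 0"
    using q_norm r_norm one_minus_nonzero[of "- q"] one_minus_nonzero[of "- r"]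
      one_minus_nonzero[of "q * q"] norm_mult_less_1[of q q]
    by (auto intro!: Q_nonzero)
  have one: "Q (- q) * Q r * Q (- r) = 1"
    using Q_duplication[OF r2, of 1] nz by (simp add: mult.assoc)
  have "askey_wilson q (- q) r (- r) = Q q"
  proof -
    have Q1: "Q (q * q) = Q q / (1 - q)" "Q (- (q * q)) = Q (- q) / (1 + q)"
      "Q (q * r) = Q r / (1 - r)" "Q (- (q * r)) = Q (- r) / (1 + r)"
      "Q (q * q * q) = Q (q * q) / (1 - q * q)"
      using nz Q_shift[of q] Q_shift[of "q * q"] Q_shift[of "- q"] Q_shift[of r] Q_shift[of "- r"]
      by (simp_all add: mult.commute)
    have rr: "r * r = q"
      using r2 by (simp add: power2_eq_square)
    have "askey_wilson q (- q) r (- r) = Q (q * q * q) /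
        (Q (- (q * q)) * Q (q * r) * Q (- (q * r)) * Q (- (q * r)) * Q (q * r) * Q (- q))"
      by (simp add: askey_wilson_def rr mult.assoc)
    also have "\<dots> = Q q * (1 + q) * ((1 - r) * (1 + r))\<^sup>2 / ((1 - q) * (1 - q * q) * (Q (- q) * Q r * Q (- r))\<^sup>2)"
      unfolding Q1 using nz by (simp add: divide_simps power2_eq_square)
    also have "(1 - r) * (1 + r) = 1 - q"
      using rr by (simp add: algebra_simps)
    also have "1 - q * q = (1 - q) * (1 + q)"
      by (simp add: algebra_simps)
    finally show ?thesis
      unfolding one using nz by (simp add: power2_eq_square)
  qed
  then show ?thesis
    using 1 nz by simp
qed

theorem askey_wilson_integral:
  assumes "cmod a < 1" "cmod b < 1" "cmod c < 1" "cmod d < 1"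
  shows "askey_integral a b c d 0 = 2 * of_real pi / Q q * askey_wilson a b c d"
  using askey_wilson_integral_up_to_constant[OF assms] by (simp add: integral_w)

section \<open>The very-well-poised series\<close>

text \<open>
The five-parameter integral is evaluated by the series whose $n$-th term is
$$\frac{1-\alpha q^{2n}}{1-\alpha q^n}\,\mathit{lower}(q^n)\,\mathit{core}_n,
\qquad q\alpha=a^2bcds .$$
The quotient is singular where $\alpha q^n=1$, and $\alpha$ may be 1 for some value of \<open>b\<close>, although
the sum has no singularity there. Since $1-\alpha x^2=x(1-\alpha x)+(1-x)$ with $x=q^n$, the term is
$q^n\,\mathit{lower}\cdot\mathit{core}_n$ plus a multiple of $1-q^n$, and the latter can be
expressed by $\mathit{core}_{n-1}$ without a division. The definition of \<open>wp_term\<close> below uses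
this form, which is regular in all parameters.
\<close>

definition wp_core ::
  "complex \<Rightarrow> complex \<Rightarrow> complex \<Rightarrow> complex \<Rightarrow> complex \<Rightarrow> nat \<Rightarrow> complex" where
  "wp_core a b c d s n = (- (b * c * d * s)) ^ n * q ^ (n * (n - 1) div 2)
     * (Q (a * b * c * d * q ^ Suc n) * Q (a * b * c * s * q ^ Suc n)
        * Q (a * b * d * s * q ^ Suc n) * Q (a * c * d * s * q ^ Suc n))
     / (qpoch q q n * Q (a\<^sup>2 * b * c * d * s * q ^ n)
        * (Q (a * b * q ^ n) * Q (a * c * q ^ n) * Q (a * d * q ^ n) * Q (a * s * q ^ n))
        * (Q (b * c) * Q (b * d) * Q (b * s) * Q (c * d) * Q (c * s) * Q (d * s)))"

definition upper ::
  "complex \<Rightarrow> complex \<Rightarrow> complex \<Rightarrow> complex \<Rightarrow> complex \<Rightarrow> complex \<Rightarrow> complex" where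
  "upper a b c d s x = (1 - a * b * x) * (1 - a * c * x) * (1 - a * d * x) * (1 - a * s * x)"

definition lower ::
  "complex \<Rightarrow> complex \<Rightarrow> complex \<Rightarrow> complex \<Rightarrow> complex \<Rightarrow> complex \<Rightarrow> complex" where
  "lower a b c d s x = (1 - a * b * c * d * x) * (1 - a * b * c * s * x)
     * (1 - a * b * d * s * x) * (1 - a * c * d * s * x)"

definition wp_term ::
  "complex \<Rightarrow> complex \<Rightarrow> complex \<Rightarrow> complex \<Rightarrow> complex \<Rightarrow> nat \<Rightarrow> complex" where
  "wp_term a b c d s n = q ^ n * lower a b c d s (q ^ n) * wp_core a b c d s n
     + (case n of 0 \<Rightarrow> 0
        | Suc m \<Rightarrow> - (b * c * d * s) * q ^ m * upper a b c d s (q ^ m) * wp_core a b c d s m)"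

definition wp_series ::
  "complex \<Rightarrow> complex \<Rightarrow> complex \<Rightarrow> complex \<Rightarrow> complex \<Rightarrow> complex" where
  "wp_series a b c d s = (\<Sum>n. wp_term a b c d s n)"

lemma wp_core_commute: "wp_core a b c d s n = wp_core a c b d s n"
  unfolding wp_core_def by (simp only: mult_ac)

lemma wp_term_commute: "wp_term a b c d s n = wp_term a c b d s n"
  unfolding wp_term_def wp_core_commute[of a b c] upper_def lower_def by (simp only: mult_ac)

lemma q_triangular_Suc: "q ^ (Suc n * (Suc n - 1) div 2) = q ^ (n * (n - 1) div 2) * q ^ n"
proof -
  have "Suc n * (Suc n - 1) = n * (n - 1) + 2 * n"
    by (cases n) (simp_all add: algebra_simps)
  then have "Suc n * (Suc n - 1) div 2 = n * (n - 1) div 2 + n"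
    by simp
  then show ?thesis
    by (simp only: power_add)
qed

lemma wp_core_Suc:
  assumes "cmod a < 1" "cmod b < 1" "cmod c < 1" "cmod d < 1" "cmod s < 1"
  shows "(1 - q ^ Suc n) * lower a b c d s (q ^ Suc n) * wp_core a b c d s (Suc n) =
    (1 - a\<^sup>2 * b * c * d * s * q ^ n) *
    (- (b * c * d * s) * q ^ n * upper a b c d s (q ^ n) * wp_core a b c d s n)"
proof -
  define x where "x = q ^ n"
  have less: "cmod (y * x) < 1" if "cmod y < 1" for y
    using that norm_mult_q_power_le[of y n] unfolding x_def by linarith
  have step: "Q (y * x * q) = Q (y * x) / (1 - y * x)" if "cmod y < 1" for y
    using Q_shift[of "y * x"] one_minus_nonzero[OF less[OF that]] by (simp add: mult.assoc)
  have step2: "(1 - y * (q * x)) * Q (y * (q * (q * x))) = Q (y * (q * x))" for y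
    using Q_shift[of "y * (q * x)"] by (simp add: mult_ac)
  have sq: "cmod (a\<^sup>2 * b * c * d * s) < 1"
    unfolding power2_eq_square by (intro norm_mult_less_1 assms)
  have qq: "1 - q * x \<noteq> 0"
    using one_minus_nonzero[OF less[OF q_norm]] .
  have nzQ: "Q (y * x) \<noteq> 0" "1 - y * x \<noteq> 0" if "cmod y < 1" for y
    using Q_nonzero[OF less[OF that]] one_minus_nonzero[OF less[OF that]] .
  define A where "A = Q (a * b * c * d * (q * x)) * Q (a * b * c * s * (q * x))
        * Q (a * b * d * s * (q * x)) * Q (a * c * d * s * (q * x))"
  define P where "P = Q (b * c) * Q (b * d) * Q (b * s) * Q (c * d) * Q (c * s) * Q (d * s)"
  define k where "k = (- (b * c * d * s)) ^ n * q ^ (n * (n - 1) div 2)"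
  define B where "B = a\<^sup>2 * b * c * d * s"
  have B: "cmod B < 1"
    using sq by (simp add: B_def)
  have core: "wp_core a b c d s n = k * A / (qpoch q q n * Q (B * x)
        * (Q (a * b * x) * Q (a * c * x) * Q (a * d * x) * Q (a * s * x)) * P)"
    by (simp add: wp_core_def x_def A_def P_def k_def B_def)
  have lowA: "lower a b c d s (q * x) * (Q (a * b * c * d * (q * (q * x))) * Q (a * b * c * s * (q * (q * x)))
        * Q (a * b * d * s * (q * (q * x))) * Q (a * c * d * s * (q * (q * x)))) = A"
    unfolding lower_def A_def step2[symmetric, of "a * b * c * d"] step2[symmetric, of "a * b * c * s"]
      step2[symmetric, of "a * b * d * s"] step2[symmetric, of "a * c * d * s"]
    by (simp only: mult_ac)
  have upx: "upper a b c d s x \<noteq> 0"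
    unfolding upper_def using assms by (simp add: nzQ(2)[unfolded right_minus_eq] norm_mult_less_1 less nzQ)
  have prod: "Q (a * b * x * q) * Q (a * c * x * q) * Q (a * d * x * q) * Q (a * s * x * q)
      = Q (a * b * x) * Q (a * c * x) * Q (a * d * x) * Q (a * s * x) / upper a b c d s x"
    by (simp add: step norm_mult_less_1 assms upper_def)
  have "lower a b c d s (q * x) * wp_core a b c d s (Suc n) =
      - (b * c * d * s) * x * k * A / (qpoch q q n * (1 - q * x) * Q (B * x * q)
        * (Q (a * b * x * q) * Q (a * c * x * q) * Q (a * d * x * q) * Q (a * s * x * q)) * P)"
    unfolding wp_core_def q_triangular_Suc qpoch_Suc power_Suc x_def[symmetric] lowA[symmetric]
    unfolding P_def B_def k_def
    by (simp add: mult_ac x_def[symmetric])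
  also have "\<dots> = - (b * c * d * s) * x * k * A / (qpoch q q n * (1 - q * x) * (Q (B * x) / (1 - B * x))
        * (Q (a * b * x) * Q (a * c * x) * Q (a * d * x) * Q (a * s * x) / upper a b c d s x) * P)"
    unfolding prod step[OF B] ..
  finally have "(1 - q * x) * (lower a b c d s (q * x) * wp_core a b c d s (Suc n)) =
      (1 - B * x) * (- (b * c * d * s) * x * upper a b c d s x * wp_core a b c d s n)"
    unfolding core using qq nzQ(2)[OF B] upx by (simp add: mult_ac)
  then show ?thesis
    by (simp add: x_def B_def mult.assoc)
qed

text \<open>
Together with \<open>lower_wp_core\<close>, this gives the term back in its usual very-well-poised form.
\<close>

lemma wp_term_very_well_poised:
  assumes "cmod a < 1" "cmod b < 1" "cmod c < 1" "cmod d < 1" "cmod s < 1"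
    and \<alpha>: "q * \<alpha> = a\<^sup>2 * b * c * d * s"
  shows "(1 - \<alpha> * q ^ n) * wp_term a b c d s n =
    (1 - \<alpha> * q ^ (2 * n)) * (lower a b c d s (q ^ n) * wp_core a b c d s n)"
proof (cases n)
  case 0
  then show ?thesis
    by (simp add: wp_term_def)
next
  case (Suc m)
  define S where "S = - (b * c * d * s) * q ^ m * upper a b c d s (q ^ m) * wp_core a b c d s m"
  define L where "L = lower a b c d s (q ^ n) * wp_core a b c d s n"
  have "wp_term a b c d s n = q ^ n * L + S"
    by (simp add: wp_term_def Suc S_def L_def)
  moreover have "(1 - q ^ n) * L = (1 - \<alpha> * q ^ n) * S"
    using wp_core_Suc[OF assms(1-5), of m] unfolding \<alpha>[symmetric] S_def L_def Suc
    by (simp add: mult_ac)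
  moreover have "(1 - \<alpha> * x) * (x * L + S) = (1 - \<alpha> * (x * x)) * L" if "(1 - x) * L = (1 - \<alpha> * x) * S" for x
    using that by algebra
  moreover have "q ^ (2 * n) = q ^ n * q ^ n"
    by (simp add: mult_2 power_add)
  ultimately have "(1 - \<alpha> * q ^ n) * wp_term a b c d s n = (1 - \<alpha> * q ^ (2 * n)) * L"
    by (simp only:)
  then show ?thesis
    by (simp add: L_def)
qed

lemma lower_wp_core:
  "lower a b c d s (q ^ n) * wp_core a b c d s n = (- (b * c * d * s)) ^ n * q ^ (n * (n - 1) div 2)
     * (Q (a * b * c * d * q ^ n) * Q (a * b * c * s * q ^ n)
        * Q (a * b * d * s * q ^ n) * Q (a * c * d * s * q ^ n))
     / (qpoch q q n * Q (a\<^sup>2 * b * c * d * s * q ^ n)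
        * (Q (a * b * q ^ n) * Q (a * c * q ^ n) * Q (a * d * q ^ n) * Q (a * s * q ^ n))
        * (Q (b * c) * Q (b * d) * Q (b * s) * Q (c * d) * Q (c * s) * Q (d * s)))"
proof -
  have step: "Q (y * q ^ n) = (1 - y * q ^ n) * Q (y * q ^ Suc n)" for y
    using Q_shift[of "y * q ^ n"] by (simp add: mult_ac)
  show ?thesis
    unfolding wp_core_def lower_def step[of "a * b * c * d"] step[of "a * b * c * s"]
      step[of "a * b * d * s"] step[of "a * c * d * s"]
    by (simp only: times_divide_eq_right mult_ac)
qed

text \<open>
Replacing \<open>b\<close> by \<open>bq\<close> replaces $\alpha$ by $\alpha q$. The denominator $1-\alpha q^{n+1}$ of the
shifted very-well-poised factor then cancels against
$(\alpha q^{n+1};q)_\infty/(\alpha q^{n+2};q)_\infty$, the change of the core, and the shifted term is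
a polynomial multiple of the unshifted core.
\<close>

lemma wp_term_shift:
  assumes a: "cmod a < 1" and b: "cmod b < 1" and c: "cmod c < 1" and d: "cmod d < 1" and s: "cmod s < 1"
  shows "wp_term a (b * q) c d s n =
    q ^ n * (1 - a\<^sup>2 * b * c * d * s * q ^ (2 * n)) * (1 - a * b * q ^ n) * (1 - a * c * d * s * q ^ n)
      * ((1 - b * c) * (1 - b * d) * (1 - b * s)) * wp_core a b c d s n"
proof -
  define x where "x = q ^ n"
  define B where "B = a\<^sup>2 * b * c * d * s"
  have bq: "cmod (b * q) < 1"
    using b norm_mult_q_le le_less_trans by blast
  have B: "cmod B < 1"
    unfolding B_def power2_eq_square by (intro norm_mult_less_1 assms)
  have Bx: "1 - B * x \<noteq> 0"
    unfolding x_def using B norm_mult_q_power_le le_less_trans by (intro one_minus_nonzero) blast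
  have abx: "1 - a * b * x \<noteq> 0"
    unfolding x_def using norm_mult_less_1[OF a b] norm_mult_q_power_le le_less_trans
    by (intro one_minus_nonzero) blast
  have nz: "1 - b * c \<noteq> 0" "1 - b * d \<noteq> 0" "1 - b * s \<noteq> 0"
    by (intro one_minus_nonzero norm_mult_less_1 b c d s)+
  define R where "R = (- (b * c * d * s)) ^ n * q ^ (n * (n - 1) div 2)
     * (Q (a * b * c * d * q ^ Suc n) * Q (a * b * c * s * q ^ Suc n)
        * Q (a * b * d * s * q ^ Suc n))"
  define S where "S = qpoch q q n * (Q (a * c * q ^ n) * Q (a * d * q ^ n) * Q (a * s * q ^ n))
        * (Q (c * d) * Q (c * s) * Q (d * s))"
  define A where "A = Q (a * c * d * s * x * q)"
  define C where "C = Q (B * x * q)"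
  define E where "E = Q (a * b * x * q)"
  define F where "F = Q (b * c * q) * Q (b * d * q) * Q (b * s * q)"
  have core: "wp_core a b c d s n = R * A / (((1 - B * x) * C) * ((1 - a * b * x) * E)
      * ((1 - b * c) * (1 - b * d) * (1 - b * s) * F) * S)"
  proof -
    have "wp_core a b c d s n = R * A / (Q (B * x) * Q (a * b * x) * (Q (b * c) * Q (b * d) * Q (b * s)) * S)"
      unfolding wp_core_def R_def S_def A_def B_def x_def power_Suc by (simp only: mult_ac)
    also have "Q (B * x) = (1 - B * x) * C"
      unfolding C_def by (rule Q_shift)
    also have "Q (a * b * x) = (1 - a * b * x) * E"
      unfolding E_def by (rule Q_shift)
    finally show ?thesis
      unfolding F_def Q_shift[of "b * c"] Q_shift[of "b * d"] Q_shift[of "b * s"]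
      by (simp only: mult_ac)
  qed
  have "lower a (b * q) c d s (q ^ n) * wp_core a (b * q) c d s n =
      x * R * ((1 - a * c * d * s * x) * A) / (C * E * F * S)"
  proof -
    have "Q (a * c * d * s * x) = (1 - a * c * d * s * x) * A"
      unfolding A_def by (rule Q_shift)
    moreover have "(- (b * q * c * d * s)) ^ n = (- (b * c * d * s)) ^ n * x"
      unfolding x_def power_mult_distrib[symmetric] by (simp add: mult_ac)
    ultimately show ?thesis
      unfolding lower_wp_core unfolding R_def S_def C_def E_def F_def B_def power_Suc
      unfolding x_def[symmetric]
      by (simp only: mult_ac)
  qed
  moreover have "(1 - B * x) * wp_term a (b * q) c d s n =
      (1 - B * q ^ (2 * n)) * (lower a (b * q) c d s (q ^ n) * wp_core a (b * q) c d s n)"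
    unfolding x_def by (rule wp_term_very_well_poised[OF a bq c d s]) (simp add: B_def)
  ultimately have "wp_term a (b * q) c d s n =
      (1 - B * q ^ (2 * n)) * (x * R * ((1 - a * c * d * s * x) * A) / (C * E * F * S)) / (1 - B * x)"
    by (simp only: nonzero_eq_divide_eq[OF Bx] mult.commute[of "wp_term a (b * q) c d s n"])
  also have "\<dots> = x * (1 - B * q ^ (2 * n)) * (1 - a * b * x) * (1 - a * c * d * s * x)
      * ((1 - b * c) * (1 - b * d) * (1 - b * s)) * wp_core a b c d s n"
    unfolding core using abx nz by (simp add: mult_ac)
  finally show ?thesis
    by (simp add: x_def B_def)
qed

section \<open>The integral with five parameters\<close>

lemma norm_mult_le_left: "cmod x \<le> r \<Longrightarrow> cmod y \<le> 1 \<Longrightarrow> cmod (x * y) \<le> r"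
  unfolding norm_mult by (metis mult_left_le norm_ge_zero order_trans)

lemma norm_mult_le_right: "cmod x \<le> 1 \<Longrightarrow> cmod y \<le> r \<Longrightarrow> cmod (x * y) \<le> r"
  using norm_mult_le_left[of y r x] by (simp add: mult.commute)

text \<open>
The bound is uniform in the parameters: uniformity in \<open>b\<close> makes the sum holomorphic in \<open>b\<close>, and
uniformity in \<open>a\<close> controls the double series that arises when \<open>a\<close> runs through $aq^k$.
\<close>

lemma wp_core_bounded:
  assumes r: "r < 1"
  shows "\<exists>M>0. \<forall>n a b c d s. cmod a \<le> r \<longrightarrow> cmod b \<le> 1 \<longrightarrow> cmod c \<le> r \<longrightarrow> cmod d \<le> r \<longrightarrow>
    cmod s \<le> r \<longrightarrow> cmod (wp_core a b c d s n) \<le> M"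
proof -
  obtain M1 where M1: "M1 > 0" "\<And>x. cmod x \<le> 1 \<Longrightarrow> cmod (Q x) \<le> M1"
    using Q_bounded[of 1] by blast
  obtain M2 where M2: "M2 > 0" "\<And>x. cmod x \<le> r \<Longrightarrow> cmod (inverse (Q x)) \<le> M2"
    using inverse_Q_bounded[OF r] by blast
  obtain M3 where M3: "M3 > 0" "\<And>n. cmod (inverse (qpoch q q n)) \<le> M3"
    using inverse_qpoch_bounded[OF Q_nonzero[OF q_norm]] by blast
  let ?M = "1 * 1 * (M1 * M1 * M1 * M1) * (M3 * M2 * (M2 * M2 * M2 * M2) * (M2 * M2 * M2 * M2 * M2 * M2))"
  have "cmod (wp_core a b c d s n) \<le> ?M"
    if a: "cmod a \<le> r" and b: "cmod b \<le> 1" and c: "cmod c \<le> r" and d: "cmod d \<le> r" and s: "cmod s \<le> r"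
    for n a b c d s
  proof -
    have le1: "cmod a \<le> 1" "cmod c \<le> 1" "cmod d \<le> 1" "cmod s \<le> 1"
      using a c d s r by auto
    have le: "cmod (x * y) \<le> 1" if "cmod x \<le> 1" "cmod y \<le> 1" for x y
      using norm_mult_le_left that by blast
    have power_le: "cmod (x ^ n) \<le> 1" if "cmod x \<le> 1" for x n
      using that by (simp add: norm_power power_le_one)
    note norms = a b c d s le1 norm_q_power_le_1
    have eq: "wp_core a b c d s n = (- (b * c * d * s)) ^ n * q ^ (n * (n - 1) div 2)
     * (Q (a * b * c * d * q ^ Suc n) * Q (a * b * c * s * q ^ Suc n)
        * Q (a * b * d * s * q ^ Suc n) * Q (a * c * d * s * q ^ Suc n))
     * (inverse (qpoch q q n) * inverse (Q (a\<^sup>2 * b * c * d * s * q ^ n))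
        * (inverse (Q (a * b * q ^ n)) * inverse (Q (a * c * q ^ n))
          * inverse (Q (a * d * q ^ n)) * inverse (Q (a * s * q ^ n)))
        * (inverse (Q (b * c)) * inverse (Q (b * d)) * inverse (Q (b * s))
          * inverse (Q (c * d)) * inverse (Q (c * s)) * inverse (Q (d * s))))"
      unfolding wp_core_def divide_inverse by (simp only: inverse_mult_distrib)
    have 0: "cmod ((- (b * c * d * s)) ^ n) \<le> 1"
      by (intro power_le) (simp only: norm_minus_cancel, intro le norms)
    have 1: "cmod (Q (a * b * c * d * q ^ Suc n)) \<le> M1" "cmod (Q (a * b * c * s * q ^ Suc n)) \<le> M1"
        "cmod (Q (a * b * d * s * q ^ Suc n)) \<le> M1" "cmod (Q (a * c * d * s * q ^ Suc n)) \<le> M1"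
      by (intro M1 le norms)+
    have ar: "cmod (a * x) \<le> r" if "cmod x \<le> 1" for x
      using norm_mult_le_left a that by blast
    have 2: "cmod (inverse (Q (a * b * q ^ n))) \<le> M2" "cmod (inverse (Q (a * c * q ^ n))) \<le> M2"
        "cmod (inverse (Q (a * d * q ^ n))) \<le> M2" "cmod (inverse (Q (a * s * q ^ n))) \<le> M2"
        "cmod (inverse (Q (a\<^sup>2 * b * c * d * s * q ^ n))) \<le> M2"
      unfolding power2_eq_square mult.assoc by (intro M2 ar le norms)+
    have 3: "cmod (inverse (Q (b * c))) \<le> M2" "cmod (inverse (Q (b * d))) \<le> M2"
        "cmod (inverse (Q (b * s))) \<le> M2" "cmod (inverse (Q (c * d))) \<le> M2"
        "cmod (inverse (Q (c * s))) \<le> M2" "cmod (inverse (Q (d * s))) \<le> M2"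
      by (intro M2 norm_mult_le_right norms)+
    have pos: "0 \<le> M1" "0 \<le> M2" "0 \<le> M3"
      using M1 M2 M3 by auto
    show ?thesis
      unfolding eq norm_mult
      by (intro mult_mono 0 1 2 3 M3 norm_q_power_le_1 mult_nonneg_nonneg pos norm_ge_zero zero_le_one)
  qed
  moreover have "?M > 0"
    using M1 M2 M3 by simp
  ultimately show ?thesis
    by blast
qed

lemma norm_four_factors_le:
  assumes "cmod y1 \<le> 1" "cmod y2 \<le> 1" "cmod y3 \<le> 1" "cmod y4 \<le> 1"
  shows "cmod ((1 - y1) * (1 - y2) * (1 - y3) * (1 - y4)) \<le> 16"
proof -
  have "cmod (1 - y) \<le> 2" if "cmod y \<le> 1" for y
    using norm_triangle_ineq4[of 1 y] that by simp
  then have "cmod ((1 - y1) * (1 - y2) * (1 - y3) * (1 - y4)) \<le> 2 * 2 * 2 * 2"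
    unfolding norm_mult using assms by (intro mult_mono mult_nonneg_nonneg) auto
  then show ?thesis
    by simp
qed

lemma wp_term_bound:
  assumes r: "r < 1"
  shows "\<exists>C>0. \<forall>n a b c d s. cmod a \<le> r \<longrightarrow> cmod b \<le> 1 \<longrightarrow> cmod c \<le> r \<longrightarrow> cmod d \<le> r \<longrightarrow>
    cmod s \<le> r \<longrightarrow> cmod (wp_term a b c d s n) \<le> C * cmod q ^ n \<and>
    cmod (- (b * c * d * s) * q ^ n * upper a b c d s (q ^ n) * wp_core a b c d s n) \<le> C * cmod q ^ n"
proof -
  obtain M where M: "M > 0" "\<And>n a b c d s. cmod a \<le> r \<Longrightarrow> cmod b \<le> 1 \<Longrightarrow> cmod c \<le> r \<Longrightarrow>
      cmod d \<le> r \<Longrightarrow> cmod s \<le> r \<Longrightarrow> cmod (wp_core a b c d s n) \<le> M"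
    using wp_core_bounded[OF r] by blast
  have "cmod (wp_term a b c d s n) \<le> (16 * M + 16 * M / cmod q) * cmod q ^ n \<and>
    cmod (- (b * c * d * s) * q ^ n * upper a b c d s (q ^ n) * wp_core a b c d s n)
      \<le> (16 * M + 16 * M / cmod q) * cmod q ^ n"
    if norms: "cmod a \<le> r" "cmod b \<le> 1" "cmod c \<le> r" "cmod d \<le> r" "cmod s \<le> r" for n a b c d s
  proof -
    have le1: "cmod a \<le> 1" "cmod c \<le> 1" "cmod d \<le> 1" "cmod s \<le> 1"
      using norms r by auto
    have le: "cmod (x * y) \<le> 1" if "cmod x \<le> 1" "cmod y \<le> 1" for x y
      using norm_mult_le_left that by blast
    have lower: "cmod (lower a b c d s (q ^ m)) \<le> 16" and upper: "cmod (upper a b c d s (q ^ m)) \<le> 16" for m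
      unfolding lower_def upper_def
      by (intro norm_four_factors_le le norms(2) le1 norm_q_power_le_1)+
    have 1: "cmod (q ^ n * lower a b c d s (q ^ n) * wp_core a b c d s n) \<le> cmod q ^ n * 16 * M"
      unfolding norm_mult norm_power
      using M(1) by (intro mult_mono mult_nonneg_nonneg lower M(2) norms) auto
    have upper_part: "cmod (- (b * c * d * s) * q ^ m * upper a b c d s (q ^ m) * wp_core a b c d s m)
        \<le> 1 * cmod q ^ m * 16 * M" for m
      unfolding norm_mult[of _ "wp_core a b c d s m"] norm_mult[of _ "upper a b c d s (q ^ m)"]
        norm_mult[of _ "q ^ m"] norm_power norm_minus_cancel
      using M(1) by (intro mult_mono mult_nonneg_nonneg upper M(2) norms le le1) auto
    have 2: "cmod (case n of 0 \<Rightarrow> 0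
        | Suc m \<Rightarrow> - (b * c * d * s) * q ^ m * upper a b c d s (q ^ m) * wp_core a b c d s m)
        \<le> cmod q ^ n * 16 * M / cmod q"
      using M(1) upper_part q_nonzero by (cases n) (simp_all add: mult.assoc)
    have "cmod (wp_term a b c d s n) \<le> cmod q ^ n * 16 * M + cmod q ^ n * 16 * M / cmod q"
      unfolding wp_term_def by (rule norm_triangle_mono[OF 1 2])
    moreover have "1 * cmod q ^ n * 16 * M \<le> cmod q ^ n * 16 * M + cmod q ^ n * 16 * M / cmod q"
      using M(1) by simp
    ultimately show ?thesis
      using upper_part[of n] by (simp add: algebra_simps)
  qed
  moreover have "16 * M + 16 * M / cmod q > 0"
    using M(1) q_nonzero by (intro add_pos_pos divide_pos_pos) auto
  ultimately show ?thesis
    by blast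
qed

lemma summable_norm_q_power: "summable (\<lambda>n. C * cmod q ^ n)"
  using q_norm by (intro summable_mult summable_geometric) simp

lemma wp_term_summable:
  assumes "cmod a < 1" "cmod b < 1" "cmod c < 1" "cmod d < 1" "cmod s < 1"
  shows "summable (\<lambda>n. wp_term a b c d s n)"
    and "summable (\<lambda>n. - (b * c * d * s) * q ^ n * upper a b c d s (q ^ n) * wp_core a b c d s n)"
proof -
  define r where "r = Max {cmod a, cmod c, cmod d, cmod s}"
  have "r < 1" "cmod a \<le> r" "cmod c \<le> r" "cmod d \<le> r" "cmod s \<le> r"
    using assms by (auto simp: r_def)
  then obtain C where C: "\<And>n. cmod (wp_term a b c d s n) \<le> C * cmod q ^ n"
    "\<And>n. cmod (- (b * c * d * s) * q ^ n * upper a b c d s (q ^ n) * wp_core a b c d s n)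
      \<le> C * cmod q ^ n"
    using wp_term_bound[of r] assms(2) by (metis (no_types) less_imp_le)
  show "summable (\<lambda>n. wp_term a b c d s n)"
    by (rule summable_comparison_test'[OF summable_norm_q_power C(1)])
  show "summable (\<lambda>n. - (b * c * d * s) * q ^ n * upper a b c d s (q ^ n) * wp_core a b c d s n)"
    by (rule summable_comparison_test'[OF summable_norm_q_power C(2)])
qed

lemma wp_series_holomorphic:
  assumes a: "cmod a < 1" and c: "cmod c < 1" and d: "cmod d < 1" and s: "cmod s < 1"
  shows "(\<lambda>b. wp_series a b c d s) holomorphic_on ball 0 1"
proof (rule holomorphic_uniform_sequence[OF open_ball])
  note less = norm_mult_less_1
  have core: "(\<lambda>b. wp_core a b c d s n) holomorphic_on ball 0 1" for n
  proof -
    have less': "cmod (x * q ^ n) < 1" if "cmod x < 1" for x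
      using norm_mult_q_power_le[of x n] that by linarith
    show ?thesis
      unfolding wp_core_def power2_eq_square using a c d s q_norm
      by (intro holomorphic_intros) (auto intro!: Q_nonzero less less' qpoch_nonzero)
  qed
  have "(\<lambda>b. wp_term a b c d s n) holomorphic_on ball 0 1" for n
    unfolding wp_term_def upper_def lower_def by (cases n) (auto intro!: holomorphic_intros core)
  then show "(\<lambda>b. \<Sum>n<N. wp_term a b c d s n) holomorphic_on ball 0 1" for N
    by (intro holomorphic_intros)
  fix x :: complex assume "x \<in> ball 0 1"
  then obtain e where e: "e > 0" "cball x e \<subseteq> ball 0 1"
    using open_contains_cball_eq[OF open_ball] by blast
  define r where "r = Max {cmod a, cmod c, cmod d, cmod s}"
  have "r < 1" "cmod a \<le> r" "cmod c \<le> r" "cmod d \<le> r" "cmod s \<le> r"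
    using assms by (auto simp: r_def)
  then obtain C where C: "\<And>n b. cmod b \<le> 1 \<Longrightarrow> cmod (wp_term a b c d s n) \<le> C * cmod q ^ n"
    using wp_term_bound[of r] by blast
  have "cmod b \<le> 1" if "b \<in> cball x e" for b
    using e(2) that by (auto simp: subset_iff less_imp_le)
  then have "uniform_limit (cball x e) (\<lambda>N b. \<Sum>n<N. wp_term a b c d s n)
      (\<lambda>b. \<Sum>n. wp_term a b c d s n) sequentially"
    by (intro Weierstrass_m_test[OF _ summable_norm_q_power[of C]] C)
  then show "\<exists>e>0. cball x e \<subseteq> ball 0 1 \<and>
      uniform_limit (cball x e) (\<lambda>N b. \<Sum>n<N. wp_term a b c d s n) (\<lambda>b. wp_series a b c d s) sequentially"
    using e unfolding wp_series_def by blast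
qed

lemma wp_series_0:
  shows "wp_series a 0 c d s = askey_wilson a c d s"
proof -
  have "wp_term a 0 c d s n = 0" if "n \<noteq> 0" for n
    using that by (cases n) (simp_all add: wp_term_def wp_core_def)
  then have "wp_series a 0 c d s = (\<Sum>n\<in>{0}. wp_term a 0 c d s n)"
    unfolding wp_series_def by (intro suminf_finite) auto
  also have "\<dots> = askey_wilson a c d s"
    unfolding askey_wilson_def Q_shift[of "a * c * d * s"]
    by (simp add: wp_term_def wp_core_def lower_def mult_ac)
  finally show ?thesis .
qed

text \<open>
Write each term as $V_n+S_{n-1}$ according to its definition, with $S_{-1}=0$. Summation by parts
replaces it by $V_n+S_n$, which is a polynomial multiple of the core, as are the terms of the two
shifted series. Termwise the relation is then a polynomial identity.
\<close>

lemma wp_series_contiguous: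
  assumes norms: "cmod a < 1" "cmod b < 1" "cmod c < 1" "cmod d < 1" "cmod s < 1"
  shows "(c - b) * (1 - b * c) * wp_series a b c d s =
    c * wp_series a (b * q) c d s - b * wp_series a b (c * q) d s"
proof -
  define V where "V n = q ^ n * lower a b c d s (q ^ n) * wp_core a b c d s n" for n
  define S where "S n = - (b * c * d * s) * q ^ n * upper a b c d s (q ^ n) * wp_core a b c d s n" for n
  define S' where "S' n = (case n of 0 \<Rightarrow> 0 | Suc m \<Rightarrow> S m)" for n
  have bq: "cmod (b * q) < 1" and cq: "cmod (c * q) < 1"
    using norms norm_mult_q_le le_less_trans by blast+
  have split: "wp_term a b c d s n = V n + S' n" for n
    by (simp add: wp_term_def V_def S'_def S_def cong: nat.case_cong)
  have point: "c * wp_term a (b * q) c d s n - b * wp_term a b (c * q) d s n =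
      (c - b) * (1 - b * c) * (V n + S n)" for n
  proof -
    define x where "x = q ^ n"
    define U where "U = wp_core a b c d s n"
    have xx: "q ^ (2 * n) = x * x"
      by (simp add: x_def mult_2 power_add)
    have 1: "wp_term a (b * q) c d s n = x * (1 - a\<^sup>2 * b * c * d * s * (x * x)) * (1 - a * b * x)
        * (1 - a * c * d * s * x) * ((1 - b * c) * (1 - b * d) * (1 - b * s)) * U"
      using wp_term_shift[OF norms, of n] by (simp only: xx x_def[symmetric] U_def[symmetric])
    have "wp_term a b (c * q) d s n = wp_term a (c * q) b d s n"
      by (rule wp_term_commute)
    then have 2: "wp_term a b (c * q) d s n = x * (1 - a\<^sup>2 * c * b * d * s * (x * x)) * (1 - a * c * x)
        * (1 - a * b * d * s * x) * ((1 - c * b) * (1 - c * d) * (1 - c * s)) * U"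
      using wp_term_shift[OF norms(1,3,2,4,5), of n] wp_core_commute[of a c b d s n]
      by (simp only: xx x_def[symmetric] U_def[symmetric])
    show ?thesis
      unfolding 1 2 V_def S_def lower_def upper_def x_def[symmetric] U_def[symmetric] by algebra
  qed
  have "S' sums t \<longleftrightarrow> S sums t" for t
    using sums_Suc_iff[of S' t] by (simp add: S'_def)
  moreover have "V n = wp_term a b c d s n - S' n" for n
    by (simp add: split)
  moreover have "summable S"
    unfolding S_def by (intro wp_term_summable norms)
  ultimately have S': "S' sums suminf S" "S sums suminf S"
    by auto
  have T: "wp_term a b c d s sums wp_series a b c d s"
    unfolding wp_series_def by (intro summable_sums wp_term_summable(1) norms)
  have "(\<lambda>n. wp_term a b c d s n - S' n + S n) sums (wp_series a b c d s - suminf S + suminf S)"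
    by (intro sums_add sums_diff T S')
  then have "(\<lambda>n. V n + S n) sums wp_series a b c d s"
    by (simp add: split)
  then have "(\<lambda>n. (c - b) * (1 - b * c) * (V n + S n)) sums ((c - b) * (1 - b * c) * wp_series a b c d s)"
    by (rule sums_mult)
  moreover have "(\<lambda>n. c * wp_term a (b * q) c d s n - b * wp_term a b (c * q) d s n)
      sums (c * wp_series a (b * q) c d s - b * wp_series a b (c * q) d s)"
    unfolding wp_series_def
    by (intro sums_diff sums_mult summable_sums wp_term_summable(1) norms bq cq)
  ultimately show ?thesis
    unfolding point by (rule sums_unique2)
qed

text \<open>
At \<open>b = 0\<close> the series has only its first term, and the integral is the Askey--Wilson integral with
parameters $a,c,d,s$. The contiguous relation in \<open>b\<close> and \<open>c\<close> does the rest.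
\<close>

theorem askey_integral_eq_wp_series:
  assumes a: "cmod a < 1" and b: "cmod b < 1" and c: "cmod c < 1" and d: "cmod d < 1" and s: "cmod s < 1"
  shows "askey_integral a b c d s = 2 * of_real pi / Q q * wp_series a b c d s"
proof -
  let ?K = "2 * of_real pi / Q q"
  have zero: "askey_integral a 0 c d s = ?K * wp_series a 0 c d s" if "cmod c < 1" for c
  proof -
    have "askey_integral a 0 c d s = askey_integral a c d s 0"
      by (simp add: askey_integral_def)
    then show ?thesis
      using askey_wilson_integral[OF a that d s] by (simp add: wp_series_0)
  qed
  have commute: "wp_series a b c d s = wp_series a c b d s" for b c
    unfolding wp_series_def wp_term_commute[of a b c] ..
  show ?thesis
  proof (cases "c = 0")
    case True
    then show ?thesis
      using zero[OF b] askey_integral_commute(2)[of a b c] commute[of b c] by simp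
  next
    case False
    define D where "D b c = askey_integral a b c d s - ?K * wp_series a b c d s" for b c
    have "D b c = 0"
    proof (rule contiguous_unique[where D = D])
      fix c :: complex assume c: "0 < cmod c" "cmod c < 1"
      have "(\<lambda>b. askey_integral a b c d s) = (\<lambda>b. askey_integral b a c d s)"
        by (rule ext) (rule askey_integral_commute(1))
      then have "(\<lambda>b. askey_integral a b c d s) holomorphic_on ball 0 1"
        using askey_integral_holomorphic[of a c d s] a c d s by simp
      then show "(\<lambda>b. D b c) holomorphic_on ball 0 1"
        unfolding D_def using a c d s by (intro holomorphic_intros wp_series_holomorphic) auto
      show "D 0 c = 0"
        using zero c by (simp add: D_def)
    next
      fix b c :: complex assume bc: "cmod b < 1" "0 < cmod c" "cmod c < 1"
      have "(c - b) * (1 - b * c) * askey_integral a b c d s =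
          c * askey_integral a (b * q) c d s - b * askey_integral a b (c * q) d s"
      proof -
        have "askey_integral x y a d s = askey_integral a x y d s" for x y
          using askey_integral_commute by metis
        then show ?thesis
          using askey_integral_contiguous[of b c a d s] a bc d s by simp
      qed
      then show "(c - b) * (1 - b * c) * D b c = c * D (b * q) c - b * D b (c * q)"
        using wp_series_contiguous[OF a bc(1,3) d s] unfolding D_def by algebra
    qed (use b c False in auto)
    then show ?thesis
      by (simp add: D_def)
  qed
qed

section \<open>The $q$-Pfaff--Saalschuetz sum\<close>

text \<open>
Up to a factor depending on $N=j+k$ alone, this is the $k$-th term of the balanced terminating
series
$${}_3\phi_2\left({{q^{-N},\,\alpha q^N,\,\alpha pr}\atop{\alpha pq,\ \alpha r}};q,q\right).$$
Using $j=N-k$ as the argument avoids the negative powers of \<open>q\<close> in $(q^{-N};q)_k$.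
\<close>

definition saalschuetz_term :: "complex \<Rightarrow> complex \<Rightarrow> complex \<Rightarrow> nat \<Rightarrow> nat \<Rightarrow> complex" where
  "saalschuetz_term \<alpha> p r j k = (- 1) ^ j * q ^ (j * (j - 1) div 2) * qpoch q \<alpha> (2 * k + j) * qpoch q (\<alpha> * p * r) k
     / (qpoch q q j * (qpoch q q k * qpoch q (\<alpha> * p * q) k * qpoch q (\<alpha> * r) k))"

lemma one_minus_q_power_nonzero: "1 - q ^ Suc n \<noteq> 0"
  using one_minus_nonzero[of "q * q ^ n"] norm_mult_q_power_le[of q n] q_norm by simp

lemma saalschuetz_term_Suc_left:
  "(1 - q ^ Suc j) * saalschuetz_term \<alpha> p r (Suc j) k = - (q ^ j * (1 - \<alpha> * q ^ (2 * k + j))) * saalschuetz_term \<alpha> p r j k"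
proof -
  have nz: "1 - q * q ^ j \<noteq> 0"
    using one_minus_q_power_nonzero[of j] by simp
  have "saalschuetz_term \<alpha> p r (Suc j) k = - (q ^ j * (1 - \<alpha> * q ^ (2 * k + j))) * saalschuetz_term \<alpha> p r j k / (1 - q * q ^ j)"
    unfolding saalschuetz_term_def q_triangular_Suc qpoch_Suc add_Suc_right by (simp add: mult_ac)
  then show ?thesis
    using nz by simp
qed

lemma saalschuetz_term_Suc_right:
  assumes "1 - \<alpha> * p * q * q ^ k \<noteq> 0" "1 - \<alpha> * r * q ^ k \<noteq> 0"
  shows "q ^ j * ((1 - q ^ Suc k) * (1 - \<alpha> * p * q * q ^ k) * (1 - \<alpha> * r * q ^ k)) * saalschuetz_term \<alpha> p r j (Suc k) =
    - ((1 - \<alpha> * q ^ (2 * k + Suc j)) * (1 - \<alpha> * p * r * q ^ k) * (1 - q ^ Suc j)) * saalschuetz_term \<alpha> p r (Suc j) k"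
proof -
  have nz: "1 - q * q ^ k \<noteq> 0" "1 - q * q ^ j \<noteq> 0" "q ^ j \<noteq> 0"
    using one_minus_q_power_nonzero[of k] one_minus_q_power_nonzero[of j] q_nonzero by simp_all
  have idx: "2 * Suc k + j = Suc (2 * k + Suc j)"
    by simp
  define X where "X = (- 1) ^ j * q ^ (j * (j - 1) div 2) * qpoch q \<alpha> (2 * k + Suc j) * qpoch q (\<alpha> * p * r) k
     / (qpoch q q j * (qpoch q q k * qpoch q (\<alpha> * p * q) k * qpoch q (\<alpha> * r) k))"
  have 1: "saalschuetz_term \<alpha> p r j (Suc k) = X * ((1 - \<alpha> * q ^ (2 * k + Suc j)) * (1 - \<alpha> * p * r * q ^ k))
      / ((1 - q * q ^ k) * (1 - \<alpha> * p * q * q ^ k) * (1 - \<alpha> * r * q ^ k))"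
    unfolding saalschuetz_term_def idx X_def qpoch_Suc by (simp only: times_divide_eq_left times_divide_eq_right divide_divide_eq_left mult_ac)
  have 2: "saalschuetz_term \<alpha> p r (Suc j) k = - X * q ^ j / (1 - q * q ^ j)"
    unfolding saalschuetz_term_def X_def qpoch_Suc[of q j] q_triangular_Suc by (simp add: mult_ac)
  show ?thesis
    unfolding 1 2 power_Suc using nz assms by simp
qed

text \<open>
The first-order recurrence for the sum over all $k\le N$, with $x=q^N$, has a certificate in the
sense of Wilf and Zeilberger. The right-hand side is that certificate; the induction on \<open>m\<close> is the
telescoping.
\<close>

lemma saalschuetz_partial_sum:
  assumes nz: "\<And>k. 1 - \<alpha> * p * q * q ^ k \<noteq> 0" "\<And>k. 1 - \<alpha> * r * q ^ k \<noteq> 0"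
    and x: "x = q ^ (m + j)"
  shows "(1 - q * x) * (1 - \<alpha> * p * q * x) * (1 - \<alpha> * r * x) * (\<Sum>k\<le>m. saalschuetz_term \<alpha> p r (Suc (m + j) - k) k)
    + x * (1 - \<alpha> * x) * (\<alpha> * (p - x) * (r - q * x)) * (\<Sum>k\<le>m. saalschuetz_term \<alpha> p r (m + j - k) k)
    = - (q ^ j * (1 - \<alpha> * q * x\<^sup>2) * (1 - \<alpha> * x * q ^ m) * (1 - \<alpha> * p * r * q ^ m)) * saalschuetz_term \<alpha> p r j m"
  using x
proof (induction m arbitrary: j)
  case 0
  define S where "S = saalschuetz_term \<alpha> p r j 0"
  have "(1 - q * x) * saalschuetz_term \<alpha> p r (Suc j) 0 = - (x * (1 - \<alpha> * x)) * S"
    using saalschuetz_term_Suc_left[of j \<alpha> p r 0] 0 by (simp add: S_def)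
  moreover have "A * (1 - \<alpha> * p * q * x) * (1 - \<alpha> * r * x) * T
      + x * (1 - \<alpha> * x) * (\<alpha> * (p - x) * (r - q * x)) * S
      = - (x * (1 - \<alpha> * q * x\<^sup>2) * (1 - \<alpha> * x) * (1 - \<alpha> * p * r)) * S"
    if "A * T = - (x * (1 - \<alpha> * x)) * S" for A T
    using that by algebra
  ultimately show ?case
    using 0 by (simp add: S_def mult_ac)
next
  case (Suc m)
  define y where "y = q ^ m"
  define z where "z = q ^ j"
  have x: "x = q * y * z"
    using Suc.prems by (simp add: y_def z_def power_add)
  let ?A = "(1 - q * x) * (1 - \<alpha> * p * q * x) * (1 - \<alpha> * r * x)"
  let ?B = "x * (1 - \<alpha> * x) * (\<alpha> * (p - x) * (r - q * x))"
  define S where "S = saalschuetz_term \<alpha> p r j (Suc m)"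
  have IH: "?A * (\<Sum>k\<le>m. saalschuetz_term \<alpha> p r (Suc (Suc m + j) - k) k) + ?B * (\<Sum>k\<le>m. saalschuetz_term \<alpha> p r (Suc m + j - k) k)
    = - (q * z * (1 - \<alpha> * q * x\<^sup>2) * (1 - \<alpha> * x * y) * (1 - \<alpha> * p * r * y)) * saalschuetz_term \<alpha> p r (Suc j) m"
    using Suc.IH[of "Suc j"] Suc.prems by (simp add: y_def z_def)
  have qz: "1 - q * z \<noteq> 0"
    using one_minus_q_power_nonzero[of j] by (simp add: z_def)
  have left: "(1 - q * z) * saalschuetz_term \<alpha> p r (Suc j) (Suc m) = - (z * (1 - \<alpha> * (q * x * y))) * S"
  proof -
    have "2 * Suc m + j = Suc (Suc (m + (m + j)))"
      by simp
    then have "q ^ (2 * Suc m + j) = q * x * y"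
      by (simp only: x y_def z_def power_Suc power_add mult_ac)
    then show ?thesis
      using saalschuetz_term_Suc_left[of j \<alpha> p r "Suc m"] by (simp add: S_def z_def)
  qed
  have right: "z * ((1 - q * y) * (1 - \<alpha> * p * q * y) * (1 - \<alpha> * r * y)) * S =
      - ((1 - \<alpha> * (x * y)) * (1 - \<alpha> * p * r * y) * (1 - q * z)) * saalschuetz_term \<alpha> p r (Suc j) m"
  proof -
    have "2 * m + Suc j = Suc (m + (m + j))"
      by simp
    then have "q ^ (2 * m + Suc j) = x * y"
      by (simp only: x y_def z_def power_Suc power_add mult_ac)
    then show ?thesis
      using saalschuetz_term_Suc_right[OF nz(1)[of m] nz(2)[of m], of j] by (simp add: S_def z_def y_def)
  qed
  have "(1 - q * z) * (?A * saalschuetz_term \<alpha> p r (Suc j) (Suc m) + ?B * S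
      - q * z * (1 - \<alpha> * q * x\<^sup>2) * (1 - \<alpha> * x * y) * (1 - \<alpha> * p * r * y) * saalschuetz_term \<alpha> p r (Suc j) m)
    = ?A * ((1 - q * z) * saalschuetz_term \<alpha> p r (Suc j) (Suc m)) + (1 - q * z) * ?B * S
      + q * z * (1 - \<alpha> * q * x\<^sup>2) * (- ((1 - \<alpha> * (x * y)) * (1 - \<alpha> * p * r * y) * (1 - q * z)) * saalschuetz_term \<alpha> p r (Suc j) m)"
    by (simp add: algebra_simps)
  also have "\<dots> = (1 - q * z) * (- (z * (1 - \<alpha> * q * x\<^sup>2) * (1 - \<alpha> * x * (q * y)) * (1 - \<alpha> * p * r * (q * y))) * S)"
    unfolding left right[symmetric] unfolding x by algebra
  finally have "?A * saalschuetz_term \<alpha> p r (Suc j) (Suc m) + ?B * S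
      - q * z * (1 - \<alpha> * q * x\<^sup>2) * (1 - \<alpha> * x * y) * (1 - \<alpha> * p * r * y) * saalschuetz_term \<alpha> p r (Suc j) m
    = - (z * (1 - \<alpha> * q * x\<^sup>2) * (1 - \<alpha> * x * (q * y)) * (1 - \<alpha> * p * r * (q * y))) * S"
    using qz by (simp only: mult_cancel_left) simp
  moreover have "A * (s1 + t1) + B * (s2 + t2) = R"
    if "A * s1 + B * s2 = - u * T" "A * t1 + B * t2 - u * T = R"
    for A B s1 s2 t1 t2 u T R :: complex
    using that by algebra
  moreover have "Suc (Suc m + j) - Suc m = Suc j" "Suc m + j - Suc m = j"
    by simp_all
  ultimately show ?case
    using IH unfolding sum.atMost_Suc power_Suc y_def[symmetric] z_def[symmetric]
    by (simp only: S_def)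
qed

text \<open>
The $q$-Pfaff--Saalschuetz sum. For \<open>m = N\<close> the certificate cancels the last term $k=N+1$ of the
next sum, which leaves a recurrence of order one without inhomogeneous term.
\<close>

lemma q_saalschuetz:
  assumes nz: "\<And>k. 1 - \<alpha> * p * q * q ^ k \<noteq> 0" "\<And>k. 1 - \<alpha> * r * q ^ k \<noteq> 0"
    and p: "p \<noteq> 0" and r: "r \<noteq> 0"
  shows "(\<Sum>k\<le>n. saalschuetz_term \<alpha> p r (n - k) k) = (- 1) ^ n * q ^ (n * (n - 1) div 2) * (\<alpha> * p * r) ^ n
     * (qpoch q \<alpha> n * qpoch q (1 / p) n * qpoch q (q / r) n)
     / (qpoch q q n * qpoch q (\<alpha> * p * q) n * qpoch q (\<alpha> * r) n)"
proof (induction n)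
  case 0
  then show ?case
    by (simp add: saalschuetz_term_def)
next
  case (Suc n)
  define x where "x = q ^ n"
  let ?A = "(1 - q * x) * (1 - \<alpha> * p * q * x) * (1 - \<alpha> * r * x)"
  let ?B = "x * (1 - \<alpha> * x) * (\<alpha> * (p - x) * (r - q * x))"
  have A: "1 - q * x \<noteq> 0" "1 - \<alpha> * p * q * x \<noteq> 0" "1 - \<alpha> * r * x \<noteq> 0"
    using one_minus_q_power_nonzero[of n] nz[of n] by (simp_all add: x_def)
  have last: "?A * saalschuetz_term \<alpha> p r 0 (Suc n)
      = (1 - \<alpha> * q * x\<^sup>2) * (1 - \<alpha> * x * x) * (1 - \<alpha> * p * r * x) * saalschuetz_term \<alpha> p r 0 n"
  proof -
    have e: "2 * Suc n + 0 = Suc (Suc (2 * n))" "q ^ (2 * n) = x * x"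
      by (simp_all add: x_def mult_2 power_add)
    show ?thesis
      unfolding saalschuetz_term_def e(1) qpoch_Suc power_Suc e(2) x_def[symmetric]
      using A by (simp add: divide_simps power2_eq_square) (simp add: mult_ac)
  qed
  have "?A * (\<Sum>k\<le>n. saalschuetz_term \<alpha> p r (Suc n - k) k) + ?B * (\<Sum>k\<le>n. saalschuetz_term \<alpha> p r (n - k) k)
    = - ((1 - \<alpha> * q * x\<^sup>2) * (1 - \<alpha> * x * x) * (1 - \<alpha> * p * r * x)) * saalschuetz_term \<alpha> p r 0 n"
    using saalschuetz_partial_sum[OF nz, where m = n and j = 0 and x = x] by (simp add: x_def)
  then have rec: "?A * (\<Sum>k\<le>Suc n. saalschuetz_term \<alpha> p r (Suc n - k) k) = - ?B * (\<Sum>k\<le>n. saalschuetz_term \<alpha> p r (n - k) k)"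
    unfolding sum.atMost_Suc diff_self_eq_0 distrib_left last by algebra
  have pr: "\<alpha> * (p - x) * (r - q * x) = \<alpha> * p * r * ((1 - 1 / p * x) * (1 - q / r * x))"
    using p r by (simp add: field_simps)
  have "(\<Sum>k\<le>Suc n. saalschuetz_term \<alpha> p r (Suc n - k) k) = - ?B * (\<Sum>k\<le>n. saalschuetz_term \<alpha> p r (n - k) k) / ?A"
    unfolding rec[symmetric] using A by simp
  also have "\<dots> = (- 1) ^ Suc n * (q ^ (n * (n - 1) div 2) * x) * (\<alpha> * p * r) ^ Suc n
     * ((qpoch q \<alpha> n * (1 - \<alpha> * x)) * (qpoch q (1 / p) n * (1 - 1 / p * x)) * (qpoch q (q / r) n * (1 - q / r * x)))
     / ((qpoch q q n * (1 - q * x)) * (qpoch q (\<alpha> * p * q) n * (1 - \<alpha> * p * q * x))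
        * (qpoch q (\<alpha> * r) n * (1 - \<alpha> * r * x)))"
    unfolding Suc.IH pr power_Suc
    by (simp only: times_divide_eq_right times_divide_eq_left divide_divide_eq_left mult_ac minus_mult_minus
        mult_minus_left mult_minus_right mult_1_left mult_1_right)
  finally show ?case
    by (simp only: q_triangular_Suc qpoch_Suc x_def)
qed

section \<open>Expansion of the integral in a double series\<close>

lemma H_bounded_below:
  assumes "r < 1"
  shows "\<exists>M>0. \<forall>a \<theta>. cmod a \<le> r \<longrightarrow> cmod (inverse (H a \<theta>)) \<le> M"
proof -
  obtain M where M: "M > 0" "\<And>x. cmod x \<le> r \<Longrightarrow> cmod (inverse (Q x)) \<le> M"
    using inverse_Q_bounded[OF assms] by blast
  have "cmod (inverse (H a \<theta>)) \<le> M * M" if "cmod a \<le> r" for a \<theta>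
    unfolding H_def inverse_mult_distrib norm_mult using M that
    by (intro mult_mono) (auto simp: norm_mult)
  then show ?thesis
    using M(1) by (intro exI[of _ "M * M"]) auto
qed

lemma qpoch_over_H:
  assumes "cmod a < 1"
  shows "qpoch q (a * cis \<theta>) k * qpoch q (a * cis (- \<theta>)) k / H a \<theta> = 1 / H (a * q ^ k) \<theta>"
proof -
  have "cmod (a * cis \<theta>) < 1" "cmod (a * cis (- \<theta>)) < 1"
    using assms by (simp_all add: norm_mult)
  moreover have "Q (a * cis \<theta>) = qpoch q (a * cis \<theta>) k * Q (a * q ^ k * cis \<theta>)"
    "Q (a * cis (- \<theta>)) = qpoch q (a * cis (- \<theta>)) k * Q (a * q ^ k * cis (- \<theta>))"
    using Q_split[of "a * cis \<theta>" k] Q_split[of "a * cis (- \<theta>)" k] by (simp_all add: mult_ac)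
  ultimately show ?thesis
    by (simp add: H_def qpoch_nonzero)
qed

text \<open>
By \<open>qpoch_over_H\<close> each term of the hypergeometric series only moves the parameter \<open>a\<close> of the
integral to $aq^k$. The geometric bound on the coefficients makes the convergence uniform.
\<close>

lemma phi_integral_expansion:
  assumes a: "cmod a < 1" and b: "cmod b < 1" and c: "cmod c < 1" and d: "cmod d < 1" and s: "cmod s < 1"
    and C: "\<And>k. cmod (C k) \<le> M * x ^ k" and x: "0 \<le> x" "x < 1"
  shows "\<exists>J. ((\<lambda>\<theta>. w \<theta> / (H a \<theta> * H b \<theta> * H c \<theta> * H d \<theta> * H s \<theta>)
      * (\<Sum>k. qpoch q (a * cis \<theta>) k * qpoch q (a * cis (- \<theta>)) k * C k)) has_integral J) {0..pi}
    \<and> (\<lambda>k. C k * askey_integral (a * q ^ k) b c d s) sums J"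
proof -
  define f where "f k \<theta> = C k * (w \<theta> / (H (a * q ^ k) \<theta> * H b \<theta> * H c \<theta> * H d \<theta> * H s \<theta>))" for k \<theta>
  have M: "0 \<le> M"
    using order_trans[OF norm_ge_zero C[of 0]] by simp
  have aq: "cmod (a * q ^ k) \<le> cmod a" for k
    by (rule norm_mult_q_power_le)
  have aq1: "cmod (a * q ^ k) < 1" for k
    using aq[of k] a by linarith
  have cont: "continuous_on A (\<lambda>\<theta>. w \<theta> / (H (a * q ^ k) \<theta> * H b \<theta> * H c \<theta> * H d \<theta> * H s \<theta>))" for A k
    using aq1[of k] b c d s by (intro continuous_intros) (simp add: H_nonzero)
  have f_cont: "continuous_on A (f k)" for A k
    unfolding f_def by (intro continuous_intros cont)
  have f_int: "(f k has_integral C k * askey_integral (a * q ^ k) b c d s) {0..pi}" for k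
    unfolding f_def askey_integral_def
    by (intro has_integral_mult_right integrable_integral integrable_continuous_real cont)
  obtain B1 where B1: "B1 > 0" "\<And>\<theta> k. cmod (inverse (H (a * q ^ k) \<theta>)) \<le> B1"
    using H_bounded_below[OF a] aq by metis
  obtain B2 where B2: "\<And>\<theta>. \<theta> \<in> {0..pi} \<Longrightarrow> cmod (w \<theta> / (H b \<theta> * H c \<theta> * H d \<theta> * H s \<theta>)) \<le> B2"
  proof -
    have "compact ((\<lambda>\<theta>. w \<theta> / (H b \<theta> * H c \<theta> * H d \<theta> * H s \<theta>)) ` {0..pi})"
      using b c d s by (intro compact_continuous_image continuous_intros compact_Icc) (simp add: H_nonzero)
    then show ?thesis
      using that compact_imp_bounded bounded_iff by (metis (no_types, lifting) image_eqI)
  qed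
  have f_bound: "cmod (f k \<theta>) \<le> M * B1 * B2 * x ^ k" if "\<theta> \<in> {0..pi}" for k \<theta>
  proof -
    have "f k \<theta> = C k * (inverse (H (a * q ^ k) \<theta>) * (w \<theta> / (H b \<theta> * H c \<theta> * H d \<theta> * H s \<theta>)))"
      by (simp add: f_def divide_inverse mult_ac)
    also have "cmod \<dots> \<le> M * x ^ k * (B1 * B2)"
      unfolding norm_mult[of "C k"] norm_mult[of "inverse _"]
      using C[of k] B1 B2[OF that] M x(1) order_trans[OF norm_ge_zero B2[OF that]]
      by (intro mult_mono mult_nonneg_nonneg norm_ge_zero) auto
    finally show ?thesis
      by (simp add: mult_ac)
  qed
  have "uniform_limit {0..pi} (\<lambda>N \<theta>. \<Sum>k<N. f k \<theta>) (\<lambda>\<theta>. \<Sum>k. f k \<theta>) sequentially"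
    using x by (intro Weierstrass_m_test[OF f_bound] summable_mult summable_geometric) auto
  moreover have "continuous_on {0..pi} (\<lambda>\<theta>. \<Sum>k<N. f k \<theta>)" for N
    by (intro continuous_intros f_cont)
  ultimately obtain I J where I: "\<And>N. ((\<lambda>\<theta>. \<Sum>k<N. f k \<theta>) has_integral I N) {0..pi}"
    and J: "((\<lambda>\<theta>. \<Sum>k. f k \<theta>) has_integral J) {0..pi}" and lim: "I \<longlonglongrightarrow> J"
    using uniform_limit_integral sequentially_bot by blast
  have "I = (\<lambda>N. \<Sum>k<N. C k * askey_integral (a * q ^ k) b c d s)"
    using has_integral_unique[OF I has_integral_sum[OF finite_lessThan f_int]] by blast
  then have sums: "(\<lambda>k. C k * askey_integral (a * q ^ k) b c d s) sums J"
    using lim by (simp only: sums_def)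
  have sum_eq: "(\<Sum>k. f k \<theta>) = w \<theta> / (H a \<theta> * H b \<theta> * H c \<theta> * H d \<theta> * H s \<theta>)
      * (\<Sum>k. qpoch q (a * cis \<theta>) k * qpoch q (a * cis (- \<theta>)) k * C k)" if "\<theta> \<in> {0..pi}" for \<theta>
  proof -
    define W where "W = w \<theta> / (H a \<theta> * H b \<theta> * H c \<theta> * H d \<theta> * H s \<theta>)"
    define g where "g k = qpoch q (a * cis \<theta>) k * qpoch q (a * cis (- \<theta>)) k * C k" for k
    have f: "f k \<theta> = W * g k" for k
    proof -
      have "f k \<theta> = C k * (w \<theta> / (H b \<theta> * H c \<theta> * H d \<theta> * H s \<theta>)) * (1 / H (a * q ^ k) \<theta>)"
        by (simp add: f_def mult_ac)
      then show ?thesis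
        unfolding qpoch_over_H[OF a, symmetric] by (simp add: W_def g_def mult_ac)
    qed
    show ?thesis
    proof (cases "W = 0")
      case True
      then show ?thesis
        by (simp add: f W_def[symmetric])
    next
      case False
      have "summable (\<lambda>k. f k \<theta>)"
      proof (rule summable_comparison_test')
        show "summable (\<lambda>k. M * B1 * B2 * x ^ k)"
          using x by (intro summable_mult summable_geometric) simp
        show "cmod (f k \<theta>) \<le> M * B1 * B2 * x ^ k" for k
          by (rule f_bound[OF that])
      qed
      then have "summable g"
        using False by (simp add: f summable_cmult_iff)
      then show ?thesis
        unfolding f W_def[symmetric] g_def[symmetric] by (rule suminf_mult)
    qed
  qed
  have "((\<lambda>\<theta>. w \<theta> / (H a \<theta> * H b \<theta> * H c \<theta> * H d \<theta> * H s \<theta>)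
      * (\<Sum>k. qpoch q (a * cis \<theta>) k * qpoch q (a * cis (- \<theta>)) k * C k)) has_integral J) {0..pi}"
    by (rule has_integral_eq[OF sum_eq J])
  then show ?thesis
    using sums by blast
qed

text \<open>
Besides factors that involve \<open>n\<close> alone, $(\alpha;q)_{2k+n}$ is all that depends on \<open>k\<close> and \<open>n\<close> separately:
the products $a\cdot q^k\cdot q^n$ and $\alpha q^{2k}\cdot q^{2n}$ depend on
\<open>n + k\<close> alone. This is what makes the double series collapse along its diagonals.
\<close>

lemma wp_term_shifted:
  assumes norms: "cmod a < 1" "cmod b < 1" "cmod c < 1" "cmod d < 1" "cmod s < 1"
    and \<alpha>: "q * \<alpha> = a\<^sup>2 * b * c * d * s" and \<alpha>_pow: "\<And>n. \<alpha> * q ^ n \<noteq> 1"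
  defines "E \<equiv> \<lambda>N. (1 - \<alpha> * q ^ (2 * N)) *
    (Q (a * b * c * d * q ^ N) * Q (a * b * c * s * q ^ N) * Q (a * b * d * s * q ^ N) * Q (a * c * d * s * q ^ N))
    / (Q \<alpha> * (Q (a * b * q ^ N) * Q (a * c * q ^ N) * Q (a * d * q ^ N) * Q (a * s * q ^ N))
       * (Q (b * c) * Q (b * d) * Q (b * s) * Q (c * d) * Q (c * s) * Q (d * s)))"
  shows "wp_term (a * q ^ k) b c d s n = E (n + k) * qpoch q \<alpha> (2 * k + n)
    * ((- (b * c * d * s)) ^ n * q ^ (n * (n - 1) div 2)) / qpoch q q n"
proof -
  define x where "x = q ^ k"
  define y where "y = q ^ n"
  have ax: "cmod (a * x) < 1"
    unfolding x_def using norm_mult_q_power_le[of a k] norms(1) by linarith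
  have yx: "q ^ (n + k) = x * y" "q ^ (2 * (n + k)) = x * x * (y * y)" "q ^ (2 * k + n) = x * x * y"
    "q ^ (2 * n) = y * y"
    unfolding x_def y_def power_add[symmetric] by (intro arg_cong[where f = "\<lambda>m. q ^ m"], simp)+
  define K where "K = (- (b * c * d * s)) ^ n * q ^ (n * (n - 1) div 2)"
  define num where "num = Q (a * b * c * d * (x * y)) * Q (a * b * c * s * (x * y))
    * Q (a * b * d * s * (x * y)) * Q (a * c * d * s * (x * y))"
  define den where "den = (Q (a * b * (x * y)) * Q (a * c * (x * y)) * Q (a * d * (x * y)) * Q (a * s * (x * y)))
       * (Q (b * c) * Q (b * d) * Q (b * s) * Q (c * d) * Q (c * s) * Q (d * s))"
  have \<alpha>x: "q * (\<alpha> * (x * x)) = (a * x)\<^sup>2 * b * c * d * s"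
    using \<alpha> by (simp add: power2_eq_square mult_ac)
  have nz: "1 - \<alpha> * (x * x * y) \<noteq> 0"
    using \<alpha>_pow[of "2 * k + n"] by (simp add: yx)
  have Q\<alpha>: "Q \<alpha> \<noteq> 0"
    using \<alpha>_pow by (simp add: Q_nonzero_iff)
  have split: "Q \<alpha> = qpoch q \<alpha> (2 * k + n) * Q (\<alpha> * (x * x * y))"
    using Q_split[of \<alpha> "2 * k + n"] by (simp add: yx)
  then have nz2: "qpoch q \<alpha> (2 * k + n) \<noteq> 0" "Q (\<alpha> * (x * x * y)) \<noteq> 0"
    using Q\<alpha> by auto
  have "lower (a * x) b c d s y * wp_core (a * x) b c d s n =
      K * num / (qpoch q q n * Q (\<alpha> * (x * x * y) * q) * den)"
  proof -
    have "(a * x)\<^sup>2 * b * c * d * s * y = \<alpha> * (x * x * y) * q"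
      unfolding \<alpha>x[symmetric] by (simp only: mult_ac)
    then show ?thesis
      unfolding y_def lower_wp_core unfolding y_def[symmetric] K_def num_def den_def
      by (simp only: mult_ac)
  qed
  moreover have "(1 - \<alpha> * (x * x) * y) * wp_term (a * x) b c d s n =
      (1 - \<alpha> * (x * x) * (y * y)) * (lower (a * x) b c d s y * wp_core (a * x) b c d s n)"
    using wp_term_very_well_poised[OF ax norms(2-5) \<alpha>x, of n] by (simp only: yx y_def[symmetric])
  ultimately have "(1 - \<alpha> * (x * x * y)) * wp_term (a * x) b c d s n =
      (1 - \<alpha> * (x * x * (y * y))) * (K * num / (qpoch q q n * Q (\<alpha> * (x * x * y) * q) * den))"
    by (simp only: mult.assoc)
  then have "wp_term (a * x) b c d s n = (1 - \<alpha> * (x * x * (y * y)))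
      * (K * num / (qpoch q q n * Q (\<alpha> * (x * x * y) * q) * den)) / (1 - \<alpha> * (x * x * y))"
    by (simp only: nonzero_eq_divide_eq[OF nz] mult.commute[of "wp_term (a * x) b c d s n"])
  also have "\<dots> = (1 - \<alpha> * (x * x * (y * y))) * K * num / (qpoch q q n * Q (\<alpha> * (x * x * y)) * den)"
    unfolding Q_shift[of "\<alpha> * (x * x * y)"] by (simp add: mult_ac)
  also have "\<dots> = (1 - \<alpha> * (x * x * (y * y))) * num / (Q \<alpha> * den) * qpoch q \<alpha> (2 * k + n) * K / qpoch q q n"
    unfolding split using nz2 by (simp add: mult_ac)
  finally show ?thesis
    unfolding E_def yx x_def[symmetric] K_def num_def den_def by (simp only: mult_ac)
qed

end

text \<open>
Summation by rows and by diagonals gives the same value, since the double series is dominated by a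
product of two geometric series.
\<close>

lemma double_series_triangle:
  fixes f :: "nat \<Rightarrow> nat \<Rightarrow> complex"
  assumes bound: "\<And>k n. cmod (f k n) \<le> M * x ^ k * y ^ n"
    and x: "0 \<le> x" "x < 1" and y: "0 \<le> y" "y < 1"
  shows "\<exists>S. (\<lambda>k. \<Sum>n. f k n) sums S \<and> (\<lambda>N. \<Sum>k\<le>N. f k (N - k)) sums S"
proof -
  have "((\<lambda>n. M * x ^ k * y ^ n) has_sum (M * x ^ k * (1 / (1 - y)))) UNIV" for k
    using y by (intro norm_summable_imp_has_sum sums_mult geometric_sums)
      (auto simp: abs_mult power_abs intro!: summable_mult summable_geometric)
  moreover have "(\<lambda>k. M * x ^ k * (1 / (1 - y))) summable_on UNIV"
    using x by (intro norm_summable_imp_summable_on)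
      (auto simp: abs_mult power_abs intro!: summable_mult summable_mult2 summable_divide summable_geometric)
  moreover have "0 \<le> M * x ^ k * y ^ n" for k n
    using bound[of k n] norm_ge_zero order_trans by blast
  ultimately have "(\<lambda>(k, n). M * x ^ k * y ^ n) summable_on UNIV \<times> UNIV"
    by (intro summable_on_SigmaI[where g = "\<lambda>k. M * x ^ k * (1 / (1 - y))"]) auto
  then have "(\<lambda>p. norm (case p of (k, n) \<Rightarrow> f k n)) summable_on UNIV \<times> UNIV"
    by (rule Infinite_Sum.abs_summable_on_comparison_test') (auto simp: bound)
  then obtain S where S: "((\<lambda>(k, n). f k n) has_sum S) (UNIV \<times> UNIV)"
    using abs_summable_summable summable_on_def by blast
  have row: "((\<lambda>n. f k n) has_sum (\<Sum>n. f k n)) UNIV" for k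
  proof -
    have "summable (\<lambda>n. norm (f k n))"
    proof (rule summable_comparison_test')
      show "summable (\<lambda>n. M * x ^ k * y ^ n)"
        using y by (intro summable_mult summable_geometric) simp
      show "norm (norm (f k n)) \<le> M * x ^ k * y ^ n" for n
        by (simp add: bound)
    qed
    then show ?thesis
      by (intro norm_summable_imp_has_sum summable_sums) (auto dest: summable_norm_cancel)
  qed
  have "((\<lambda>k. \<Sum>n. f k n) has_sum S) UNIV"
    by (rule has_sum_SigmaD[OF S]) (simp add: row)
  moreover have "((\<lambda>N. \<Sum>k\<le>N. f k (N - k)) has_sum S) UNIV"
  proof (rule has_sum_SigmaD[where B = "\<lambda>N. {..N}" and f = "\<lambda>(N, k). f k (N - k)"])
    have "((\<lambda>(N, k). f k (N - k)) has_sum S) (Sigma UNIV (\<lambda>N. {..N})) =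
        ((\<lambda>(k, n). f k n) has_sum S) (UNIV \<times> UNIV)"
      by (rule has_sum_reindex_bij_witness[where i = "\<lambda>(k, n). (k + n, k)" and j = "\<lambda>(N, k). (k, N - k)"])
        auto
    then show "((\<lambda>(N, k). f k (N - k)) has_sum S) (Sigma UNIV (\<lambda>N. {..N}))"
      using S by simp
  qed (simp add: has_sum_finite)
  ultimately show ?thesis
    using has_sum_imp_sums by blast
qed

section \<open>The integral with a hypergeometric factor\<close>

theorem theorem1p6:
  fixes q \<alpha> a b c d s u v :: complex
  assumes "q \<noteq> 0" and "cmod q < 1"
    and "a \<noteq> 0" and "u \<noteq> 0" and "v \<noteq> 0" and "\<alpha> \<noteq> 1"
    and "\<And>n. \<alpha> * u * q ^ n \<noteq> 1" and "\<And>n. \<alpha> * v * q ^ n \<noteq> 1"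
    and "q * \<alpha> = a\<^sup>2 * b * c * d * s"
    and "Max {cmod a, cmod b, cmod c, cmod d, cmod s} < 1"
  shows "((\<lambda>\<theta>. hs q (cos (2 * \<theta>)) [1] / hs q (cos \<theta>) [a, b, c, d, s]
            * phi32 q (a * exp (\<i> * of_real \<theta>)) (a * exp (- (\<i> * of_real \<theta>))) (\<alpha> * u * v / q)
                (\<alpha> * u) (\<alpha> * v) (b * c * d * s))
          has_integral
          2 * of_real pi
            * qpochs_inf q [a * b * c * d, a * b * c * s, a * b * d * s, a * c * d * s]
            / qpochs_inf q [q, a * b, a * c, a * d, a * s, b * c, b * d, b * s,
                c * d, c * s, d * s, q * \<alpha>]
            * (\<Sum>n. (1 - \<alpha> * q ^ (2 * n))
                * qpochs q [\<alpha>, q / u, q / v, a * b, a * c, a * d, a * s] n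
                / ((1 - \<alpha>) * qpochs q [q, \<alpha> * u, \<alpha> * v, a * b * c * d, a * b * c * s,
                      a * b * d * s, a * c * d * s] n)
                * (- (\<alpha>\<^sup>2 * u * v / a\<^sup>2)) ^ n * q ^ (n * (n - 1) div 2)))
         {0..pi}"
proof -
  interpret nome q
    by unfold_locales (use assms(1,2) in auto)
  note \<alpha> = assms(9)
  have a: "cmod a < 1" and b: "cmod b < 1" and c: "cmod c < 1" and d: "cmod d < 1" and s: "cmod s < 1"
    using assms(10) by simp_all
  note less = norm_mult_less_1
  have \<alpha>_pow: "\<alpha> * q ^ n \<noteq> 1" for n
  proof (cases n)
    case 0
    then show ?thesis
      using assms(6) by simp
  next
    case (Suc m)
    have "\<alpha> * q ^ n = a\<^sup>2 * b * c * d * s * q ^ m"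
      unfolding \<alpha>[symmetric] Suc by (simp add: mult_ac)
    moreover have "cmod (a\<^sup>2 * b * c * d * s) < 1"
      unfolding power2_eq_square by (intro less a b c d s)
    ultimately have "cmod (\<alpha> * q ^ n) < 1"
      using norm_mult_q_power_le le_less_trans by metis
    then show ?thesis
      by (metis less_irrefl norm_one)
  qed
  define K where "K = b * c * d * s"
  \<comment> \<open>With $p=u/q$ and $r=v$ the parameters of the Saalschuetz sum are $\alpha uv/q$, $\alpha u$ and $\alpha v$.\<close>
  define p where "p = u / q"
  have pv: "\<alpha> * p * v = \<alpha> * u * v / q" "\<alpha> * p * q = \<alpha> * u" "1 / p = q / u" "p \<noteq> 0"
    using assms(1,4) by (simp_all add: p_def)
  define C where "C k = qpoch q (\<alpha> * p * v) k
    / (qpoch q q k * qpoch q (\<alpha> * u) k * qpoch q (\<alpha> * v) k) * K ^ k" for k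
  have K: "cmod K < 1"
    unfolding K_def by (intro less b c d s)
  have Quv: "Q (\<alpha> * u) \<noteq> 0" "Q (\<alpha> * v) \<noteq> 0"
    using assms(7,8) by (auto simp: Q_nonzero_iff)
  obtain M where M: "\<And>k. cmod (C k) \<le> M * cmod K ^ k"
  proof -
    obtain M1 where M1: "M1 > 0" "\<And>k. cmod (qpoch q (\<alpha> * p * v) k) \<le> M1"
      using qpoch_bounded by blast
    obtain M2 where M2: "M2 > 0" "\<And>k. cmod (inverse (qpoch q q k)) \<le> M2"
      using inverse_qpoch_bounded[OF Q_nonzero[OF q_norm]] by blast
    obtain M3 where M3: "M3 > 0" "\<And>k. cmod (inverse (qpoch q (\<alpha> * u) k)) \<le> M3"
      using inverse_qpoch_bounded[OF Quv(1)] by blast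
    obtain M4 where M4: "M4 > 0" "\<And>k. cmod (inverse (qpoch q (\<alpha> * v) k)) \<le> M4"
      using inverse_qpoch_bounded[OF Quv(2)] by blast
    have "cmod (C k) \<le> (M1 * (M2 * M3 * M4)) * cmod K ^ k" for k
      unfolding C_def divide_inverse inverse_mult_distrib norm_mult norm_power
      using M1 M2 M3 M4 by (intro mult_mono mult_nonneg_nonneg) auto
    then show ?thesis
      by (rule that)
  qed
  obtain J where J: "((\<lambda>\<theta>. w \<theta> / (H a \<theta> * H b \<theta> * H c \<theta> * H d \<theta> * H s \<theta>)
      * (\<Sum>k. qpoch q (a * cis \<theta>) k * qpoch q (a * cis (- \<theta>)) k * C k)) has_integral J) {0..pi}"
    and J_sums: "(\<lambda>k. C k * askey_integral (a * q ^ k) b c d s) sums J"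
    using phi_integral_expansion[OF a b c d s M norm_ge_zero K] by blast
  have integrand: "hs q (cos (2 * \<theta>)) [1] / hs q (cos \<theta>) [a, b, c, d, s]
            * phi32 q (a * exp (\<i> * of_real \<theta>)) (a * exp (- (\<i> * of_real \<theta>))) (\<alpha> * u * v / q)
                (\<alpha> * u) (\<alpha> * v) (b * c * d * s)
      = w \<theta> / (H a \<theta> * H b \<theta> * H c \<theta> * H d \<theta> * H s \<theta>)
      * (\<Sum>k. qpoch q (a * cis \<theta>) k * qpoch q (a * cis (- \<theta>)) k * C k)" for \<theta>
  proof -
    have e: "exp (\<i> * of_real \<theta>) = cis \<theta>" "exp (- (\<i> * of_real \<theta>)) = cis (- \<theta>)"
      by (simp_all add: cis_conv_exp)
    show ?thesis
      unfolding phi32_def hs_def qpochs_def h_eq_H e C_def pv K_def[symmetric]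
      by (simp add: w_def h_eq_H mult_ac)
  qed
  \<comment> \<open>Up to constant factors, the integral is the sum of \<open>f\<close> by rows, and the claimed series its sum by diagonals.\<close>
  define f where "f k n = C k * wp_term (a * q ^ k) b c d s n" for k n
  define r where "r = Max {cmod a, cmod b, cmod c, cmod d, cmod s}"
  have r: "r < 1" "cmod a \<le> r" "cmod c \<le> r" "cmod d \<le> r" "cmod s \<le> r"
    using assms(10) by (auto simp: r_def)
  have aqr: "cmod (a * q ^ k) \<le> r" for k
    using norm_mult_q_power_le[of a k] r(2) by linarith
  obtain B where B: "B > 0" "\<And>n k. cmod (wp_term (a * q ^ k) b c d s n) \<le> B * cmod q ^ n"
    using wp_term_bound[OF r(1)] aqr r b by (metis less_imp_le)
  have M0: "0 \<le> M"
    using order_trans[OF norm_ge_zero M[of 0]] by simp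
  have "cmod (f k n) \<le> (M * B) * cmod K ^ k * cmod q ^ n" for k n
  proof -
    have "cmod (f k n) \<le> (M * cmod K ^ k) * (B * cmod q ^ n)"
      unfolding f_def norm_mult using M0 by (intro mult_mono M B) auto
    then show ?thesis
      by (simp add: mult_ac)
  qed
  then obtain S where rows: "(\<lambda>k. \<Sum>n. f k n) sums S"
    and diagonals: "(\<lambda>N. \<Sum>k\<le>N. f k (N - k)) sums S"
    using double_series_triangle[of f "M * B" "cmod K" "cmod q"] K q_norm by auto
  have J_eq: "J = 2 * of_real pi / Q q * S"
  proof -
    have eq: "C k * askey_integral (a * q ^ k) b c d s = 2 * of_real pi / Q q * (\<Sum>n. f k n)" for k
    proof -
      have aq: "cmod (a * q ^ k) < 1"
        using aqr[of k] r(1) by linarith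
      have "(\<Sum>n. f k n) = C k * wp_series (a * q ^ k) b c d s"
        unfolding f_def wp_series_def by (intro suminf_mult wp_term_summable aq b c d s)
      then show ?thesis
        unfolding askey_integral_eq_wp_series[OF aq b c d s] by simp
    qed
    have "(\<lambda>k. C k * askey_integral (a * q ^ k) b c d s) sums (2 * of_real pi / Q q * S)"
      unfolding eq by (rule sums_mult[OF rows])
    then show ?thesis
      using J_sums sums_unique2 by blast
  qed
  define E where "E N = (1 - \<alpha> * q ^ (2 * N)) *
    (Q (a * b * c * d * q ^ N) * Q (a * b * c * s * q ^ N) * Q (a * b * d * s * q ^ N) * Q (a * c * d * s * q ^ N))
    / (Q \<alpha> * (Q (a * b * q ^ N) * Q (a * c * q ^ N) * Q (a * d * q ^ N) * Q (a * s * q ^ N))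
       * (Q (b * c) * Q (b * d) * Q (b * s) * Q (c * d) * Q (c * s) * Q (d * s)))" for N
  have diagonal: "f k (N - k) = E N * K ^ N * saalschuetz_term \<alpha> p v (N - k) k" if "k \<le> N" for k N
  proof -
    have N: "N - k + k = N"
      using that by simp
    have "(- K) ^ (N - k) = (- 1) ^ (N - k) * K ^ (N - k)"
      by (rule power_minus)
    moreover have "K ^ N = K ^ (N - k) * K ^ k"
      by (simp add: N flip: power_add)
    moreover have "wp_term (a * q ^ k) b c d s (N - k) = E N * qpoch q \<alpha> (2 * k + (N - k))
      * ((- K) ^ (N - k) * q ^ ((N - k) * (N - k - 1) div 2)) / qpoch q q (N - k)"
      using wp_term_shifted[OF a b c d s \<alpha> \<alpha>_pow, of k "N - k"]
      unfolding N E_def[symmetric] K_def[symmetric] .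
    ultimately show ?thesis
      unfolding f_def C_def saalschuetz_term_def pv(2) by (simp add: mult_ac)
  qed
  define rhs_term where "rhs_term n = (1 - \<alpha> * q ^ (2 * n))
                * qpochs q [\<alpha>, q / u, q / v, a * b, a * c, a * d, a * s] n
                / ((1 - \<alpha>) * qpochs q [q, \<alpha> * u, \<alpha> * v, a * b * c * d, a * b * c * s,
                      a * b * d * s, a * c * d * s] n)
                * (- (\<alpha>\<^sup>2 * u * v / a\<^sup>2)) ^ n * q ^ (n * (n - 1) div 2)" for n
  \<comment> \<open>The constant in front of the claimed series, without $2\pi/(q;q)_\infty$.\<close>
  define c0 where "c0 = Q (a * b * c * d) * Q (a * b * c * s) * Q (a * b * d * s) * Q (a * c * d * s)
    / (Q (a * b) * Q (a * c) * Q (a * d) * Q (a * s)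
       * (Q (b * c) * Q (b * d) * Q (b * s) * Q (c * d) * Q (c * s) * Q (d * s)) * Q (q * \<alpha>))"
  have Q_pow: "Q (x * q ^ n) = Q x / qpoch q x n" if "cmod x < 1" for x n
    using Q_split[of x n] qpoch_nonzero[OF that, of n] by simp
  have E: "E n = c0 * ((1 - \<alpha> * q ^ (2 * n)) * (qpoch q (a * b) n * qpoch q (a * c) n * qpoch q (a * d) n
      * qpoch q (a * s) n) / ((1 - \<alpha>) * (qpoch q (a * b * c * d) n * qpoch q (a * b * c * s) n
        * qpoch q (a * b * d * s) n * qpoch q (a * c * d * s) n)))" for n
  proof -
    have Q\<alpha>: "Q \<alpha> = (1 - \<alpha>) * Q (q * \<alpha>)"
      using Q_shift[of \<alpha>] by (simp add: mult.commute)
    have "cmod (a * b * c * d) < 1" "cmod (a * b * c * s) < 1" "cmod (a * b * d * s) < 1"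
      "cmod (a * c * d * s) < 1" "cmod (a * b) < 1" "cmod (a * c) < 1" "cmod (a * d) < 1" "cmod (a * s) < 1"
      by (intro less a b c d s)+
    note Qs = this[THEN Q_pow, of n]
    show ?thesis
      unfolding E_def c0_def Qs Q\<alpha> by (simp add: mult_ac)
  qed
  have power: "(- (\<alpha>\<^sup>2 * u * v / a\<^sup>2)) ^ n = (- 1) ^ n * K ^ n * (\<alpha> * p * v) ^ n" for n
  proof -
    have "\<alpha>\<^sup>2 * u * v / a\<^sup>2 = (q * \<alpha>) * (\<alpha> * u * v / q) / a\<^sup>2"
      using assms(1) by (simp add: power2_eq_square)
    also have "\<dots> = K * (\<alpha> * p * v)"
      unfolding \<alpha> pv K_def using assms(3) by simp
    finally show ?thesis
      by (simp add: power_minus[of "K * (\<alpha> * p * v)"] power_mult_distrib)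
  qed
  have nz: "1 - \<alpha> * p * q * q ^ k \<noteq> 0" "1 - \<alpha> * v * q ^ k \<noteq> 0" for k
    unfolding pv(2) using assms(7)[of k] assms(8)[of k] by auto
  have "(\<Sum>k\<le>N. f k (N - k)) = c0 * rhs_term N" for N
  proof -
    have "(\<Sum>k\<le>N. f k (N - k)) = E N * K ^ N * (\<Sum>k\<le>N. saalschuetz_term \<alpha> p v (N - k) k)"
      by (simp add: diagonal sum_distrib_left)
    also have "\<dots> = c0 * rhs_term N"
      unfolding q_saalschuetz[OF nz pv(4) assms(5)] E rhs_term_def power qpochs_def pv(2,3)
      by (simp add: mult_ac)
    finally show ?thesis .
  qed
  then have "(\<lambda>N. c0 * rhs_term N) sums S"
    using diagonals by simp
  moreover have "c0 \<noteq> 0"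
  proof -
    have "cmod (q * \<alpha>) < 1"
      unfolding \<alpha> power2_eq_square by (intro less a b c d s)
    then show ?thesis
      by (simp add: c0_def Q_nonzero less a b c d s)
  qed
  ultimately have "S = c0 * (\<Sum>n. rhs_term n)"
    by (metis sums_mult_D sums_unique suminf_mult sums_summable)
  then have "J = 2 * of_real pi
            * qpochs_inf q [a * b * c * d, a * b * c * s, a * b * d * s, a * c * d * s]
            / qpochs_inf q [q, a * b, a * c, a * d, a * s, b * c, b * d, b * s,
                c * d, c * s, d * s, q * \<alpha>] * (\<Sum>n. rhs_term n)"
    by (simp add: J_eq c0_def qpochs_inf_def mult_ac)
  then show ?thesis
    using J unfolding integrand rhs_term_def by simp
qed

end
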